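(* Let $A>0$ and $y_0\ge 2$ be fixed, let $f$ be a positive function on $[y_0,\infty)$, and write $u=\frac{\log x}{\log y}$. We have $$R(x,y)\ll x f(y) e^{-A u} \qquad (x\ge 1,\ y\ge y_0)$$ if and only if $$\Delta(x,y)\ll x f(y) e^{-A u} \qquad (x\ge 1, \ y\ge y_0).$$
   Context: Notation. $F(x,y)\ll G(x,y)$ on a given range of $(x,y)$ means that there is a constant $C$, independent of $x$ and $y$ (but possibly depending on the fixed parameters), with $|F(x,y)|\le C\,G(x,y)$ for all $(x,y)$ in that range. $\gamma$ is Euler's constant; $\{x\}$ is the fractional part of $x$; $p$ denotes primes; $1_{x\ge1}$ equals $1$ if $x\ge 1$ and $0$ otherwise. Throughout $u=\log x/\log y$. $\rho$ is Dickman's function: $\rho(u)=0$ for $u<0$, $\rho(u)=1$ for $0\le u\le 1$, $\rho$ is continuous on $[0,\infty)$ and $u\rho'(u)=-\rho(u-1)$ for $u>1$; $\rho'(u)$ is defined by right-continuity at $u=0,1$ (so $\rho'(0)=0$, $\rho'(1)=-1$). $\omega$ is Buchstab's function: $\omega(u)=0$ for $u<1$, $\omega(u)=1/u$ for $1\le u\le 2$, $\omega$ is continuous on $[1,\infty)$ and $(u\omega(u))'=\omega(u-1)$ for $u>2$. $\mathcal S_y$ is the set of positive integers all of whose prime factors are $\le y$ (so $1\in\mathcal S_y$). $\Psi(x,y)=|\mathcal S_y\cap[1,x]|$. $\Phi(x,y)$ is the number of integers $1\le n\le x$ all of whose prime factors are $>y$ (including $n=1$). $\Pi(y)=\prod_{p\le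 y}(1-1/p)$. $\mu_y(u)=\int_0^u \omega(u-v)y^{-v}\,dv$ (so $\mu_y(u)=0$ for $u<1$, including $u<0$). For $x\ge1$, $y\ge2$: $$\Lambda(x,y)= x \rho(u)-\{x\}-x\int_0^u \rho'(u-v) \frac{\{y^v\}}{y^v}\, dv,\qquad \Delta(x,y)=\Psi(x,y)-\Lambda(x,y).$$ For $x>0$, $y\ge 2$: $$V(x,y)=1_{x\ge 1} + x \Big( \Pi(y) - \frac{e^{-\gamma}}{\log y} +\mu_y(u)\Big),\qquad Q(x,y)=V(x,y)-\Phi(x,y),\qquad R(x,y)=\sum_{n\in\mathcal S_y}Q(x/n,y),$$ where the sum is over all of the set $\mathcal S_y$ (it converges absolutely). *)

theory Defs
  imports "HOL-Analysis.Analysis" "HOL-Computational_Algebra.Primes"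
begin

definition is_dickman :: "(real \<Rightarrow> real) \<Rightarrow> bool" where
  "is_dickman r \<longleftrightarrow>
     (\<forall>u<0. r u = 0) \<and> (\<forall>u. 0 \<le> u \<and> u \<le> 1 \<longrightarrow> r u = 1) \<and>
     continuous_on {0..} r \<and>
     (\<forall>u>1. r differentiable (at u) \<and> u * deriv r u = - r (u - 1))"

definition is_buchstab :: "(real \<Rightarrow> real) \<Rightarrow> bool" where
  "is_buchstab w \<longleftrightarrow>
     (\<forall>u<1. w u = 0) \<and> (\<forall>u. 1 \<le> u \<and> u \<le> 2 \<longrightarrow> w u = 1 / u) \<and>
     continuous_on {1..} w \<and>
     (\<forall>u>2. ((\<lambda>t. t * w t) has_real_derivative w (u - 1)) (at u))"

lemma delay_fixpoint:
  fixes T :: "(real \<Rightarrow> real) \<Rightarrow> real \<Rightarrow> real" and a :: real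
  assumes loc: "\<And>f g u. u > a \<Longrightarrow> (\<And>t. t \<le> u - 1 \<Longrightarrow> f t = g t) \<Longrightarrow> T f u = T g u"
    and base: "\<And>f g u. u \<le> a \<Longrightarrow> T f u = T g u"
  shows "\<exists>r. T r = r"
proof -
  define F where "F n = (T ^^ n) (\<lambda>_. 0)" for n
  have FS: "F (Suc n) = T (F n)" for n
    by (simp add: F_def)
  have step: "\<forall>u \<le> a + real n. F (Suc n) u = F (Suc (Suc n)) u" for n
  proof (induction n)
    case 0
    show ?case using base by (auto simp: FS)
  next
    case (Suc n)
    show ?case
    proof (intro allI impI)
      fix u assume u: "u \<le> a + real (Suc n)"
      have "T (F (Suc n)) u = T (F (Suc (Suc n))) u"
      proof (cases "u \<le> a")
        case True
        then show ?thesis by (rule base)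
      next
        case False
        show ?thesis
          by (rule loc) (use False u Suc.IH in auto)
      qed
      then show "F (Suc (Suc n)) u = F (Suc (Suc (Suc n))) u"
        by (simp add: FS)
    qed
  qed
  have stable: "F (Suc n + k) u = F (Suc n) u" if "u \<le> a + real n" for n k u
  proof (induction k)
    case (Suc k)
    have "F (Suc (n + k)) u = F (Suc (Suc (n + k))) u"
      using step[of "n + k"] that by simp
    with Suc show ?case by simp
  qed simp
  define N where "N u = nat \<lceil>u - a\<rceil>" for u :: real
  define r where "r u = F (Suc (N u)) u" for u
  have N: "u \<le> a + real (N u)" for u
    unfolding N_def by linarith
  have r: "r u = F (Suc n) u" if "u \<le> a + real n" for u n
  proof -
    have "N u \<le> n" unfolding N_def using that by linarith
    then obtain k where "n = N u + k" by (metis le_Suc_ex)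
    then show ?thesis using stable[OF N, of u k] by (simp add: r_def)
  qed
  have "T r u = r u" for u
  proof -
    have "T r u = T (F (Suc (N u))) u"
    proof (cases "u \<le> a")
      case True
      then show ?thesis by (rule base)
    next
      case False
      show ?thesis
      proof (rule loc)
        fix t assume "t \<le> u - 1"
        then have "t \<le> a + real (N u)" using N[of u] by linarith
        then show "r t = F (Suc (N u)) t" by (rule r)
      qed (use False in simp)
    qed
    also have "\<dots> = F (Suc (N u + 1)) u"
      by (simp add: FS)
    also have "\<dots> = r u"
      using stable[OF N, of u 1] by (simp add: r_def)
    finally show ?thesis .
  qed
  then show ?thesis by blast
qed

text \<open>Method of steps: continuity of the fixed point of the integrated delay equation
  propagates from \<open>[b, b + n]\<close> to \<open>[b, b + n + 1]\<close>.\<close>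

lemma delay_continuous:
  fixes r k :: "real \<Rightarrow> real" and b c :: real
  assumes k: "continuous_on {b+1..} k"
    and init: "continuous_on {b..b+1} r"
    and eq: "\<And>u. u \<ge> b + 1 \<Longrightarrow> r u * h u = c + integral {b+1..u} (\<lambda>t. k t * r (t - 1))"
    and h: "continuous_on {b+1..} h" "\<And>u. u \<ge> b + 1 \<Longrightarrow> h u \<noteq> 0"
  shows "continuous_on {b..} r"
    and "\<And>u. u > b + 1 \<Longrightarrow>
           ((\<lambda>u. r u * h u) has_real_derivative k u * r (u - 1)) (at u)"
proof -
  have ci: "continuous_on {b+1..d} (\<lambda>t. k t * r (t - 1))" if "continuous_on {b..d - 1} r" for d
  proof (intro continuous_intros)
    show "continuous_on {b+1..d} k" by (rule continuous_on_subset[OF k]) auto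
    show "continuous_on {b+1..d} (\<lambda>t. r (t - 1))"
      by (rule continuous_on_compose2[OF that]) (auto intro!: continuous_intros)
  qed
  have n: "continuous_on {b..b + 1 + real n} r" for n
  proof (induction n)
    case 0
    then show ?case using init by simp
  next
    case (Suc n)
    let ?d = "b + 1 + real (Suc n)"
    have c1: "continuous_on {b+1..?d} (\<lambda>u. (c + integral {b+1..u} (\<lambda>t. k t * r (t - 1))) / h u)"
    proof (intro continuous_on_divide continuous_on_add continuous_on_const
        indefinite_integral_continuous_1 integrable_continuous_real ci)
      show "continuous_on {b..?d - 1} r" using Suc by (simp add: algebra_simps)
      show "continuous_on {b+1..?d} h" by (rule continuous_on_subset[OF h(1)]) auto
    qed (use h(2) in auto)
    have c2: "continuous_on {b+1..?d} r"
    proof (rule continuous_on_eq[OF c1])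
      fix u assume "u \<in> {b+1..?d}"
      then show "(c + integral {b+1..u} (\<lambda>t. k t * r (t - 1))) / h u = r u"
        using eq[of u] h(2)[of u] by (simp add: field_simps)
    qed
    have "{b..?d} = {b..b+1} \<union> {b+1..?d}" by auto
    with continuous_on_closed_Un[OF _ _ init c2] show ?case by simp
  qed
  show cont: "continuous_on {b..} r"
    unfolding continuous_on_eq_continuous_within
  proof
    fix u assume u: "u \<in> {b..}"
    obtain m :: nat where m: "real m > u - b - 1" using reals_Archimedean2 by blast
    have "continuous (at u within {b..b+1+real m}) r"
      using n[of m] u m by (auto simp: continuous_on_eq_continuous_within)
    moreover have "at u within {b..b+1+real m} = at u within {b..}"
      by (rule at_within_nhd[of _ "{..<b+1+real m}"]) (use m in auto)
    ultimately show "continuous (at u within {b..}) r"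
      by (simp add: continuous_within)
  qed
  fix u :: real assume u: "u > b + 1"
  have "continuous_on {b+1..u+1} (\<lambda>t. k t * r (t - 1))"
    by (rule ci, rule continuous_on_subset[OF cont]) auto
  then have "((\<lambda>u. integral {b+1..u} (\<lambda>t. k t * r (t - 1))) has_real_derivative k u * r (u - 1))
      (at u within {b+1..u+1})"
    by (rule integral_has_real_derivative) (use u in auto)
  then have "((\<lambda>u. integral {b+1..u} (\<lambda>t. k t * r (t - 1))) has_real_derivative k u * r (u - 1)) (at u)"
    using at_within_Icc_at[of "b+1" u "u+1"] u by simp
  then have "((\<lambda>u. c + integral {b+1..u} (\<lambda>t. k t * r (t - 1))) has_real_derivative k u * r (u - 1)) (at u)"
    by (auto intro!: derivative_eq_intros)
  then show "((\<lambda>u. r u * h u) has_real_derivative k u * r (u - 1)) (at u)"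
  proof (rule has_field_derivative_transform_within_open)
    show "open {b+1<..}" by simp
  qed (use u eq in auto)
qed

text \<open>Uniqueness for the same equations, again step by step.\<close>

lemma delay_unique:
  fixes r s h k :: "real \<Rightarrow> real" and b :: real
  assumes init: "\<And>u. u \<le> b + 1 \<Longrightarrow> r u = s u"
    and cont: "continuous_on {b..} r" "continuous_on {b..} s" "continuous_on {b..} h"
    and h: "\<And>u. u > b + 1 \<Longrightarrow> h u \<noteq> 0"
    and r: "\<And>u. u > b + 1 \<Longrightarrow> ((\<lambda>u. r u * h u) has_real_derivative k u * r (u - 1)) (at u)"
    and s: "\<And>u. u > b + 1 \<Longrightarrow> ((\<lambda>u. s u * h u) has_real_derivative k u * s (u - 1)) (at u)"
  shows "r = s"
proof
  have n: "\<forall>u \<le> b + 1 + real n. r u = s u" for n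
  proof (induction n)
    case 0
    then show ?case using init by simp
  next
    case (Suc n)
    let ?a = "b + 1 + real n"
    show ?case
    proof (intro allI impI)
      fix u assume u: "u \<le> b + 1 + real (Suc n)"
      show "r u = s u"
      proof (cases "u \<le> ?a")
        case True
        then show ?thesis using Suc by blast
      next
        case False
        have "(\<lambda>u. r u * h u - s u * h u) u = (\<lambda>u. r u * h u - s u * h u) ?a"
        proof (rule DERIV_isconst_end[where f = "\<lambda>u. r u * h u - s u * h u"])
          show "?a < u" using False by simp
          show "continuous_on {?a..u} (\<lambda>u. r u * h u - s u * h u)"
            by (intro continuous_intros continuous_on_subset[OF cont(1)]
                continuous_on_subset[OF cont(2)] continuous_on_subset[OF cont(3)]) auto
          fix t assume t: "?a < t" "t < u"
          have "((\<lambda>u. r u * h u - s u * h u) has_real_derivative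
                  k t * r (t - 1) - k t * s (t - 1)) (at t)"
            by (intro DERIV_diff r s) (use t in auto)
          moreover have "r (t - 1) = s (t - 1)" using Suc t u by auto
          ultimately show "((\<lambda>u. r u * h u - s u * h u) has_real_derivative 0) (at t)" by simp
        qed
        also have "\<dots> = 0" using Suc by simp
        finally show ?thesis using h[of u] False by (simp flip: left_diff_distrib)
      qed
    qed
  qed
  fix u
  obtain m :: nat where "real m > u - b - 1" using reals_Archimedean2 by blast
  then show "r u = s u" using n[of m] by auto
qed

lemma is_dickman_deriv:
  assumes "is_dickman r" "u > 1"
  shows "(r has_real_derivative - r (u - 1) / u) (at u)"
proof -
  from assms have d: "r differentiable (at u)" and e: "u * deriv r u = - r (u - 1)"
    by (auto simp: is_dickman_def)
  from e assms(2) have "deriv r u = - r (u - 1) / u" by (simp add: field_simps)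
  with d show ?thesis
    by (metis DERIV_deriv_iff_real_differentiable)
qed

lemma ex1_dickman: "\<exists>!r. is_dickman r"
proof (rule ex_ex1I)
  define T where "T f u = (if u < 0 then 0 else if u \<le> 1 then 1
      else 1 + integral {1..u} (\<lambda>t. (- 1 / t) * f (t - 1)))" for f :: "real \<Rightarrow> real" and u :: real
  have "\<exists>r. T r = r"
  proof (rule delay_fixpoint[where a = 1])
    fix f g :: "real \<Rightarrow> real" and u :: real
    assume u: "1 < u" and fg: "\<And>t. t \<le> u - 1 \<Longrightarrow> f t = g t"
    have "integral {1..u} (\<lambda>t. (- 1 / t) * f (t - 1)) = integral {1..u} (\<lambda>t. (- 1 / t) * g (t - 1))"
      by (rule integral_cong) (simp add: fg)
    then show "T f u = T g u" by (simp add: T_def)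
  qed (simp add: T_def)
  then obtain r where r: "T r = r" ..
  have neg: "r u = 0" if "u < 0" for u
    using that by (subst r[symmetric]) (simp add: T_def)
  have one: "r u = 1" if "0 \<le> u" "u \<le> 1" for u
    using that by (subst r[symmetric]) (simp add: T_def)
  have eq: "r u * 1 = 1 + integral {0+1..u} (\<lambda>t. (- 1 / t) * r (t - 1))" if "u \<ge> 0 + 1" for u
  proof (cases "u = 1")
    case True
    then show ?thesis using one[of 1] by simp
  next
    case False
    have "r u = T r u" by (simp add: r)
    also have "\<dots> = 1 + integral {1..u} (\<lambda>t. (- 1 / t) * r (t - 1))"
      using False that by (simp add: T_def)
    finally show ?thesis by simp
  qed
  have c0: "continuous_on {0..0+1} r"
    by (rule continuous_on_eq[OF continuous_on_const[of _ 1]]) (simp add: one)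
  have ck: "continuous_on {0+1..} (\<lambda>t :: real. - 1 / t)"
    by (auto intro!: continuous_intros)
  note dc = delay_continuous[where b = 0 and h = "\<lambda>_. 1" and k = "\<lambda>t. - 1 / t" and r = r,
      OF ck c0 eq continuous_on_const one_neq_zero]
  have "r differentiable (at u) \<and> u * deriv r u = - r (u - 1)" if "u > 1" for u
  proof -
    have d: "(r has_real_derivative - 1 / u * r (u - 1)) (at u)"
      using dc(2)[of u] that by simp
    then show ?thesis
      using DERIV_imp_deriv[OF d] that real_differentiable_def by auto
  qed
  then have "is_dickman r"
    using neg one dc(1) by (auto simp: is_dickman_def)
  then show "\<exists>r. is_dickman r" by blast
next
  fix r s assume rs: "is_dickman r" "is_dickman s"
  show "r = s"
  proof (rule delay_unique[where b = 0 and h = "\<lambda>_. 1" and k = "\<lambda>t. - 1 / t"])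
    fix u :: real assume "u \<le> 0 + 1"
    then show "r u = s u" using rs by (cases "u < 0") (auto simp: is_dickman_def)
  next
    fix u :: real assume "u > 0 + 1"
    then show "((\<lambda>u. r u * 1) has_real_derivative - 1 / u * r (u - 1)) (at u)"
      and "((\<lambda>u. s u * 1) has_real_derivative - 1 / u * s (u - 1)) (at u)"
      using is_dickman_deriv[OF rs(1), of u] is_dickman_deriv[OF rs(2), of u] by auto
  qed (use rs in \<open>auto simp: is_dickman_def\<close>)
qed

lemma ex1_buchstab: "\<exists>!w. is_buchstab w"
proof (rule ex_ex1I)
  define T where "T f u = (if u < 1 then 0 else if u \<le> 2 then 1 / u
      else (1 + integral {2..u} (\<lambda>t. 1 * f (t - 1))) / u)" for f :: "real \<Rightarrow> real" and u :: real
  have "\<exists>r. T r = r"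
  proof (rule delay_fixpoint[where a = 2])
    fix f g :: "real \<Rightarrow> real" and u :: real
    assume u: "2 < u" and fg: "\<And>t. t \<le> u - 1 \<Longrightarrow> f t = g t"
    have "integral {2..u} (\<lambda>t. 1 * f (t - 1)) = integral {2..u} (\<lambda>t. 1 * g (t - 1))"
      by (rule integral_cong) (simp add: fg)
    then show "T f u = T g u" by (simp add: T_def)
  qed (simp add: T_def)
  then obtain w where w: "T w = w" ..
  have neg: "w u = 0" if "u < 1" for u
    using that by (subst w[symmetric]) (simp add: T_def)
  have one: "w u = 1 / u" if "1 \<le> u" "u \<le> 2" for u
    using that by (subst w[symmetric]) (simp add: T_def)
  have eq: "w u * u = 1 + integral {1+1..u} (\<lambda>t. 1 * w (t - 1))" if "u \<ge> 1 + 1" for u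
  proof (cases "u = 2")
    case True
    then show ?thesis using one[of 2] by simp
  next
    case False
    have "w u = T w u" by (simp add: w)
    also have "\<dots> = (1 + integral {2..u} (\<lambda>t. 1 * w (t - 1))) / u"
      using False that by (simp add: T_def)
    finally show ?thesis using that by simp
  qed
  have "continuous_on {1..1+1} (\<lambda>u :: real. 1 / u)"
    by (auto intro!: continuous_intros)
  then have c0: "continuous_on {1..1+1} w"
    by (rule continuous_on_eq) (simp add: one)
  have nz: "u \<ge> 1 + 1 \<Longrightarrow> u \<noteq> 0" for u :: real by auto
  note dc = delay_continuous[where b = 1 and h = "\<lambda>u. u" and k = "\<lambda>_. 1" and r = w,
      OF continuous_on_const c0 eq continuous_on_id nz]
  have "((\<lambda>t. t * w t) has_real_derivative w (u - 1)) (at u)" if "u > 2" for u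
    using dc(2)[of u] that by (simp add: mult.commute)
  then have "is_buchstab w"
    using neg one dc(1) by (auto simp: is_buchstab_def)
  then show "\<exists>w. is_buchstab w" by blast
next
  fix r s assume rs: "is_buchstab r" "is_buchstab s"
  show "r = s"
  proof (rule delay_unique[where b = 1 and h = "\<lambda>u. u" and k = "\<lambda>_. 1"])
    fix u :: real assume "u \<le> 1 + 1"
    then show "r u = s u" using rs by (cases "u < 1") (auto simp: is_buchstab_def)
  next
    fix u :: real assume "u > 1 + 1"
    then show "((\<lambda>u. r u * u) has_real_derivative 1 * r (u - 1)) (at u)"
      and "((\<lambda>u. s u * u) has_real_derivative 1 * s (u - 1)) (at u)"
      using rs by (auto simp: is_buchstab_def mult.commute)
  qed (use rs in \<open>auto simp: is_buchstab_def intro!: continuous_intros\<close>)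
qed

definition dickman :: "real \<Rightarrow> real" where
  "dickman = (THE r. is_dickman r)"

definition buchstab :: "real \<Rightarrow> real" where
  "buchstab = (THE w. is_buchstab w)"

lemma is_dickman_dickman: "is_dickman dickman"
  unfolding dickman_def by (rule theI'[OF ex1_dickman])

lemma is_buchstab_buchstab: "is_buchstab buchstab"
  unfolding buchstab_def by (rule theI'[OF ex1_buchstab])

text \<open>The derivative of \<^const>\<open>dickman\<close>, extended by right-continuity to the two points 0 and 1,
  where \<^const>\<open>dickman\<close> is not differentiable.\<close>

definition dickman' :: "real \<Rightarrow> real" where
  "dickman' u = (if u = 0 \<or> u = 1 then Lim (at_right u) (deriv dickman) else deriv dickman u)"

lemma deriv_dickman_gt_1: "u > 1 \<Longrightarrow> deriv dickman u = - dickman (u - 1) / u"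
  by (rule DERIV_imp_deriv[OF is_dickman_deriv[OF is_dickman_dickman]])

lemma deriv_dickman_0_1:
  assumes "0 < u" "u < 1"
  shows "deriv dickman u = 0"
proof (rule DERIV_imp_deriv)
  show "(dickman has_real_derivative 0) (at u)"
    by (rule has_field_derivative_transform_within_open[OF DERIV_const, of "{0<..<1}" _ 1])
      (use assms is_dickman_dickman in \<open>auto simp: is_dickman_def\<close>)
qed

lemma dickman'_0: "dickman' 0 = 0"
proof -
  have ev: "eventually (\<lambda>u. deriv dickman u = 0) (at_right 0)"
    unfolding eventually_at_right_field by (rule exI[of _ 1]) (auto intro: deriv_dickman_0_1)
  then have "(deriv dickman \<longlongrightarrow> 0) (at_right 0)"
    by (rule tendsto_eventually)
  then show ?thesis
    by (simp add: dickman'_def tendsto_Lim)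
qed

lemma dickman'_1: "dickman' 1 = - 1"
proof -
  have one: "dickman u = 1" if "0 \<le> u" "u \<le> 1" for u
    using is_dickman_dickman that by (auto simp: is_dickman_def)
  have "((\<lambda>u :: real. - 1 / u) \<longlongrightarrow> - 1 / 1) (at_right 1)"
    by (intro tendsto_intros) auto
  moreover have "eventually (\<lambda>u. - 1 / u = deriv dickman u) (at_right (1 :: real))"
    unfolding eventually_at_right_field
    by (rule exI[of _ 2]) (auto simp: deriv_dickman_gt_1 one)
  ultimately have "(deriv dickman \<longlongrightarrow> - 1) (at_right 1)"
    by (simp add: tendsto_cong)
  then show ?thesis
    by (simp add: dickman'_def tendsto_Lim)
qed

definition smooth :: "real \<Rightarrow> nat set" where
  "smooth y = {n. n > 0 \<and> (\<forall>p. prime p \<longrightarrow> p dvd n \<longrightarrow> real p \<le> y)}"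

definition rough :: "real \<Rightarrow> nat set" where
  "rough y = {n. n > 0 \<and> (\<forall>p. prime p \<longrightarrow> p dvd n \<longrightarrow> real p > y)}"

definition Psi :: "real \<Rightarrow> real \<Rightarrow> nat" where
  "Psi x y = card {n \<in> smooth y. real n \<le> x}"

definition Phi :: "real \<Rightarrow> real \<Rightarrow> nat" where
  "Phi x y = card {n \<in> rough y. real n \<le> x}"

definition prime_prod :: "real \<Rightarrow> real" where
  "prime_prod y = (\<Prod>p | prime p \<and> real p \<le> y. 1 - 1 / real (p :: nat))"

text \<open>For \<open>u < 0\<close> the interval \<open>{0..u}\<close> is empty, so that \<open>mu y u = 0\<close>.\<close>

definition mu :: "real \<Rightarrow> real \<Rightarrow> real" where
  "mu y u = integral {0..u} (\<lambda>v. buchstab (u - v) * y powr (- v))"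

definition Lambda :: "real \<Rightarrow> real \<Rightarrow> real" where
  "Lambda x y = (let u = ln x / ln y in
     x * dickman u - frac x
       - x * integral {0..u} (\<lambda>v. dickman' (u - v) * (frac (y powr v) / y powr v)))"

definition Delta :: "real \<Rightarrow> real \<Rightarrow> real" where
  "Delta x y = real (Psi x y) - Lambda x y"

definition V :: "real \<Rightarrow> real \<Rightarrow> real" where
  "V x y = (let u = ln x / ln y in
     (if x \<ge> 1 then 1 else 0)
       + x * (prime_prod y - exp (- euler_mascheroni) / ln y + mu y u))"

definition Q :: "real \<Rightarrow> real \<Rightarrow> real" where
  "Q x y = V x y - real (Phi x y)"

definition R :: "real \<Rightarrow> real \<Rightarrow> real" where
  "R x y = (\<Sum>\<^sub>\<infinity>n\<in>smooth y. Q (x / real n) y)"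

end

theory Submission imports Defs begin

text \<open>
  Put \<open>x = y\<^sup>u\<close> and divide everything by \<open>x\<close>: let \<open>P(u) = \<Psi>(x,y)/x\<close>, \<open>g(u) = {x}/x\<close>,
  \<open>L(u) = \<Lambda>(x,y)/x\<close>, \<open>D = P - L = \<Delta>/x\<close>, and \<open>E(u) = R(x,y)/x\<close>. Write \<open>*\<close> for the convolution of
  functions supported on \<open>[0,\<infinity>)\<close> and \<open>e\<close> for the indicator of \<open>[0,\<infinity>)\<close>. (Below, \<open>P\<close>, \<open>g\<close>, \<open>L\<close>, \<open>D\<close> are
  \<open>smooth_density\<close>, \<open>frac_density\<close>, \<open>lambda_density\<close>, \<open>delta_density\<close>.)

  Two identities tie \<open>E\<close> to \<open>D\<close>. On the arithmetic side, every positive integer is uniquely a product of a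
  smooth and a rough one, so \<open>\<Sum> \<Phi>(x/n,y) = \<lfloor>x\<rfloor>\<close> over smooth \<open>n\<close>, while \<open>\<Sum> 1/n = 1/\<Pi>(y)\<close> over the same
  \<open>n\<close>. Summing the definition of \<open>Q\<close> gives \<open>E = P + g - 1 + c + \<omega>*P\<close> with
  \<open>c = 1 - e\<^sup>-\<^sup>\<gamma> / (\<Pi>(y) log y)\<close>. On the analytic side, \<open>\<delta> + \<rho>'\<close> and \<open>\<delta> + \<omega>\<close> are inverse to each
  other under convolution, that is, \<open>\<rho>' + \<omega> + \<rho>'*\<omega> = 0\<close> (\<open>dickman'_buchstab_inverse\<close>). As
  \<open>L = \<rho> - g - \<rho>'*g\<close>, this gives \<open>L + \<omega>*L = e - g\<close>, and therefore
  \<open>E = c + D + \<omega>*D\<close> (\<open>R_eq_delta_density\<close>), with inverse \<open>D = E + \<rho>'*E - c\<rho>\<close>.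

  From \<open>R\<close> to \<open>\<Delta>\<close>: the value at \<open>u = 0\<close> is \<open>E(0) = c\<close>, so the bound for \<open>R\<close> at \<open>x = 1\<close> bounds \<open>c\<close>. Since
  \<open>\<rho>\<close> and \<open>\<rho>'\<close> decay faster than any exponential, all three terms in the formula for \<open>D\<close> inherit the
  bound \<open>f(y) e\<^sup>-\<^sup>A\<^sup>u\<close> (\<open>dickman_transform_bound\<close>).

  From \<open>\<Delta>\<close> to \<open>R\<close>: here \<open>\<omega>\<close> does not decay, but \<open>\<omega>(u) - e\<^sup>-\<^sup>\<gamma>\<close> does, faster than any exponential
  (\<open>buchstab_decay\<close>). For fixed \<open>y\<close> one has \<open>E(u) \<rightarrow> 0\<close>: this follows from \<open>P(u) \<rightarrow> 0\<close>, from
  \<open>\<integral> P = 1/(\<Pi>(y) log y)\<close>, and from \<open>\<omega> \<rightarrow> e\<^sup>-\<^sup>\<gamma>\<close> (\<open>R_density_tendsto_0\<close>). Comparing with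
  \<open>E = c + D + \<omega>*D\<close> yields \<open>c + e\<^sup>-\<^sup>\<gamma> \<integral> D = 0\<close>, and the constant \<open>c\<close> can be eliminated:
  \<open>E = D + (\<omega> - e\<^sup>-\<^sup>\<gamma>)*D\<close>, the last convolution being over the whole line
  (\<open>buchstab_transform_bound\<close>).

  That the limit of \<open>\<omega>\<close> is \<open>e\<^sup>-\<^sup>\<gamma>\<close> amounts, by \<open>\<rho> + \<omega>*\<rho> = e\<close>, to \<open>\<integral> \<rho> = e\<^sup>\<gamma>\<close>. The latter comes from the
  Laplace transform \<open>F\<close> of \<open>\<rho>\<close>, which satisfies \<open>F'(s) = - F(s) (1 - e\<^sup>-\<^sup>s)/s\<close> and \<open>s F(s) \<rightarrow> 1\<close>, and from
  \<open>\<integral>\<^sub>0\<^sup>n (1 - e\<^sup>-\<^sup>t)/t dt = log n + \<gamma> + o(1)\<close>.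
\<close>

section \<open>Convolution of causal functions\<close>

text \<open>Causal functions (zero on the negative axis, bounded on every \<open>(-\<infinity>, T]\<close>) form an algebra under
  convolution in which no integrability at infinity has to be checked: only \<open>[0, u]\<close> contributes to
  the value at \<open>u\<close>.\<close>

definition causal :: "(real \<Rightarrow> real) \<Rightarrow> bool" where
  "causal f \<longleftrightarrow> f \<in> borel_measurable borel \<and> (\<forall>t<0. f t = 0) \<and> (\<forall>T. \<exists>M. \<forall>t\<le>T. \<bar>f t\<bar> \<le> M)"

text \<open>The integral is over the whole line, so that associativity and shifts need no bookkeeping of
  end points, and so that one factor may also be a function that does not vanish on the negative
  axis, as in the final estimate for \<open>R\<close>.\<close>

definition conv :: "(real \<Rightarrow> real) \<Rightarrow> (real \<Rightarrow> real) \<Rightarrow> real \<Rightarrow> real" where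
  "conv f g u = (LINT v|lborel. f (u - v) * g v)"

lemma causal_measurable [measurable_dest]: "causal f \<Longrightarrow> f \<in> borel_measurable borel"
  by (simp add: causal_def)

lemma causal_neg: "causal f \<Longrightarrow> t < 0 \<Longrightarrow> f t = 0"
  by (simp add: causal_def)

lemma causal_bound:
  assumes "causal f" obtains M where "M \<ge> 0" "\<And>t. t \<le> T \<Longrightarrow> \<bar>f t\<bar> \<le> M"
proof -
  from assms have "\<exists>M. \<forall>t\<le>T. \<bar>f t\<bar> \<le> M" unfolding causal_def by blast
  then obtain M where M: "\<forall>t\<le>T. \<bar>f t\<bar> \<le> M" ..
  then have "M \<ge> 0" using abs_ge_zero[of "f T"] order_trans by blast
  with M that show ?thesis by blast
qed

lemma causalI:
  assumes "f \<in> borel_measurable borel" "\<And>t. t < 0 \<Longrightarrow> f t = 0"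
    and "\<And>T. \<exists>M. \<forall>t. 0 \<le> t \<longrightarrow> t \<le> T \<longrightarrow> \<bar>f t\<bar> \<le> M"
  shows "causal f"
  unfolding causal_def
proof (intro conjI allI impI)
  fix T
  obtain M where "\<forall>t. 0 \<le> t \<longrightarrow> t \<le> T \<longrightarrow> \<bar>f t\<bar> \<le> M" using assms(3) by blast
  then have "\<bar>f t\<bar> \<le> max 0 M" if "t \<le> T" for t
    using that assms(2)[of t] by (cases "t < 0") (auto simp: le_max_iff_disj)
  then show "\<exists>M. \<forall>t\<le>T. \<bar>f t\<bar> \<le> M" by blast
qed (use assms in auto)

lemma causal_boundedI:
  assumes "f \<in> borel_measurable borel" "\<And>t. t < 0 \<Longrightarrow> f t = 0" "\<And>t. t \<ge> 0 \<Longrightarrow> \<bar>f t\<bar> \<le> M"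
  shows "causal f"
  using assms by (intro causalI) auto

lemma causal_mult:
  assumes f: "causal f" and [measurable]: "g \<in> borel_measurable borel"
    and "\<And>T. \<exists>M. \<forall>t. 0 \<le> t \<longrightarrow> t \<le> T \<longrightarrow> \<bar>g t\<bar> \<le> M"
  shows "causal (\<lambda>t. f t * g t)"
proof (rule causalI)
  note causal_measurable[OF f, measurable]
  show "(\<lambda>t. f t * g t) \<in> borel_measurable borel" by measurable
  fix T
  obtain M where "M \<ge> 0" "\<And>t. t \<le> T \<Longrightarrow> \<bar>f t\<bar> \<le> M" using causal_bound[OF f, of T] by metis
  moreover obtain N where "\<forall>t. 0 \<le> t \<longrightarrow> t \<le> T \<longrightarrow> \<bar>g t\<bar> \<le> N" using assms(3)[of T] ..
  ultimately show "\<exists>M. \<forall>t. 0 \<le> t \<longrightarrow> t \<le> T \<longrightarrow> \<bar>f t * g t\<bar> \<le> M"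
    by (intro exI[of _ "M * N"]) (auto simp: abs_mult intro!: mult_mono' )
qed (use causal_neg[OF f] in auto)

lemma causal_add:
  assumes f: "causal f" and g: "causal g"
  shows "causal (\<lambda>t. f t + g t)"
proof (rule causalI)
  note causal_measurable[OF f, measurable] causal_measurable[OF g, measurable]
  show "(\<lambda>t. f t + g t) \<in> borel_measurable borel" by measurable
  fix T
  obtain M where "M \<ge> 0" "\<And>t. t \<le> T \<Longrightarrow> \<bar>f t\<bar> \<le> M" using causal_bound[OF f, of T] by metis
  moreover obtain N where "N \<ge> 0" "\<And>t. t \<le> T \<Longrightarrow> \<bar>g t\<bar> \<le> N" using causal_bound[OF g, of T] by metis
  ultimately show "\<exists>M. \<forall>t. 0 \<le> t \<longrightarrow> t \<le> T \<longrightarrow> \<bar>f t + g t\<bar> \<le> M"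
    by (intro exI[of _ "M + N"]) (auto intro: order_trans[OF abs_triangle_ineq] add_mono)
qed (use causal_neg[OF f] causal_neg[OF g] in auto)

lemma causal_scale: "causal f \<Longrightarrow> causal (\<lambda>t. c * f t)"
  using causal_mult[of f "\<lambda>_. c"] by (auto simp: mult.commute)

lemma causal_uminus: "causal f \<Longrightarrow> causal (\<lambda>t. - f t)"
  using causal_scale[of f "-1"] by simp

lemma causal_diff: "causal f \<Longrightarrow> causal g \<Longrightarrow> causal (\<lambda>t. f t - g t)"
  using causal_add[OF _ causal_uminus] by fastforce

lemma causal_times_arg:
  assumes "causal f" shows "causal (\<lambda>t. t * f t)"
proof -
  have "causal (\<lambda>t. f t * t)"
    using assms by (rule causal_mult) (auto intro!: exI)
  then show ?thesis by (simp add: mult.commute)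
qed

lemma causal_times_exp:
  assumes "causal f" shows "causal (\<lambda>t. f t * exp (c * t))"
proof (rule causal_mult[OF assms])
  fix T
  have "c * t \<le> \<bar>c\<bar> * \<bar>T\<bar>" if "0 \<le> t" "t \<le> T" for t
  proof -
    have "c * t \<le> \<bar>c\<bar> * t" using that by (intro mult_right_mono) auto
    also have "\<dots> \<le> \<bar>c\<bar> * \<bar>T\<bar>" using that by (intro mult_left_mono) auto
    finally show ?thesis .
  qed
  then show "\<exists>M. \<forall>t. 0 \<le> t \<longrightarrow> t \<le> T \<longrightarrow> \<bar>exp (c * t)\<bar> \<le> M"
    by (intro exI[of _ "exp (\<bar>c\<bar> * \<bar>T\<bar>)"]) simp
qed measurable

lemma causal_shift:
  assumes f: "causal f" and "a \<ge> 0" shows "causal (\<lambda>t. f (t - a))"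
proof (rule causalI)
  note causal_measurable[OF f, measurable]
  show "(\<lambda>t. f (t - a)) \<in> borel_measurable borel" by measurable
  fix T
  obtain M where "M \<ge> 0" "\<And>t. t \<le> T \<Longrightarrow> \<bar>f t\<bar> \<le> M" using causal_bound[OF f, of T] by metis
  then show "\<exists>M. \<forall>t. 0 \<le> t \<longrightarrow> t \<le> T \<longrightarrow> \<bar>f (t - a)\<bar> \<le> M" using \<open>a \<ge> 0\<close>
    by (intro exI[of _ M]) auto
qed (use causal_neg[OF f] \<open>a \<ge> 0\<close> in auto)

lemma conv_integrable:
  assumes f: "causal f" and g: "causal g"
  shows "integrable lborel (\<lambda>v. f (u - v) * g v)"
proof -
  note causal_measurable[OF f, measurable] causal_measurable[OF g, measurable]
  obtain M where M: "M \<ge> 0" "\<And>t. t \<le> u \<Longrightarrow> \<bar>f t\<bar> \<le> M" using causal_bound[OF f] by metis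
  obtain N where N: "N \<ge> 0" "\<And>t. t \<le> u \<Longrightarrow> \<bar>g t\<bar> \<le> N" using causal_bound[OF g] by metis
  show ?thesis
  proof (rule integrableI_bounded_set[where A = "{0..u}" and B = "M * N"])
    show "AE v in lborel. v \<in> {0..u} \<longrightarrow> norm (f (u - v) * g v) \<le> M * N"
      using M N by (auto simp: abs_mult intro!: mult_mono')
    show "AE v in lborel. v \<notin> {0..u} \<longrightarrow> f (u - v) * g v = 0"
      using causal_neg[OF f] causal_neg[OF g] by auto
    show "emeasure lborel {0..u} < \<infinity>"
      by (cases "0 \<le> u") auto
  qed auto
qed

lemma conv_neg: 
  assumes f: "causal f" and g: "causal g" and "u < 0"
  shows "conv f g u = 0"
proof -
  have "(\<lambda>v. f (u - v) * g v) = (\<lambda>_. 0)"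
  proof
    fix v
    show "f (u - v) * g v = 0"
      using causal_neg[OF f, of "u - v"] causal_neg[OF g, of v] \<open>u < 0\<close> by (cases "v < 0") auto
  qed
  then show ?thesis unfolding conv_def by (simp only: Bochner_Integration.integral_zero)
qed

lemma causal_conv:
  assumes f: "causal f" and g: "causal g"
  shows "causal (conv f g)"
proof (rule causalI)
  note causal_measurable[OF f, measurable] causal_measurable[OF g, measurable]
  have "(\<lambda>u. LINT v|lborel. f (u - v) * g v) \<in> borel_measurable borel"
    by measurable
  then show "conv f g \<in> borel_measurable borel" unfolding conv_def [abs_def] .
  fix T
  obtain M where M: "M \<ge> 0" "\<And>t. t \<le> T \<Longrightarrow> \<bar>f t\<bar> \<le> M" using causal_bound[OF f] by metis
  obtain N where N: "N \<ge> 0" "\<And>t. t \<le> T \<Longrightarrow> \<bar>g t\<bar> \<le> N" using causal_bound[OF g] by metis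
  have "\<bar>conv f g u\<bar> \<le> M * N * T" if "0 \<le> u" "u \<le> T" for u
  proof -
    have "\<bar>conv f g u\<bar> \<le> (LINT v|lborel. M * N * indicator {0..T} v)"
      unfolding conv_def
    proof (rule integral_abs_bound[THEN order_trans], rule integral_mono)
      show "integrable lborel (\<lambda>v. \<bar>f (u - v) * g v\<bar>)"
        using conv_integrable[OF f g] by (rule integrable_abs)
      show "integrable lborel (\<lambda>v. M * N * indicator {0..T} v)"
        using that by (intro integrable_mult_right integrable_real_indicator) auto
      fix v
      show "\<bar>f (u - v) * g v\<bar> \<le> M * N * indicator {0..T} v"
      proof (cases "v \<in> {0..T}")
        case True then show ?thesis using M N that by (auto simp: abs_mult intro!: mult_mono')
      next
        case False
        then show ?thesis using causal_neg[OF f, of "u - v"] causal_neg[OF g, of v] that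
          by (cases "v < 0") auto
      qed
    qed
    then show ?thesis using that by simp
  qed
  then show "\<exists>M. \<forall>t. 0 \<le> t \<longrightarrow> t \<le> T \<longrightarrow> \<bar>conv f g t\<bar> \<le> M" by blast
qed (use conv_neg[OF f g] in auto)

lemma conv_commute: "conv f g = conv g f"
proof
  fix u
  have "conv f g u = \<bar>-1\<bar> *\<^sub>R (LINT v|lborel. f (u - (u + (-1) * v)) * g (u + (-1) * v))"
    unfolding conv_def by (rule lborel_integral_real_affine) simp
  then show "conv f g u = conv g f u" by (simp add: conv_def mult.commute)
qed

lemma conv_assoc:
  assumes f: "causal f" and g: "causal g" and h: "causal h"
  shows "conv (conv f g) h = conv f (conv g h)"
proof
  fix u
  note causal_measurable[OF f, measurable] causal_measurable[OF g, measurable] causal_measurable[OF h, measurable]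
  obtain M where M: "M \<ge> 0" "\<And>t. t \<le> u \<Longrightarrow> \<bar>f t\<bar> \<le> M" using causal_bound[OF f] by metis
  obtain N where N: "N \<ge> 0" "\<And>t. t \<le> u \<Longrightarrow> \<bar>g t\<bar> \<le> N" using causal_bound[OF g] by metis
  obtain K where K: "K \<ge> 0" "\<And>t. t \<le> u \<Longrightarrow> \<bar>h t\<bar> \<le> K" using causal_bound[OF h] by metis
  let ?k = "\<lambda>t v. f (u - t) * (g (t - v) * h v)"
  have z: "?k t v = 0" if "(t, v) \<notin> {0..u} \<times> {0..u}" for t v
    using that causal_neg[OF f, of "u - t"] causal_neg[OF g, of "t - v"] causal_neg[OF h, of v]
    by (cases "v < 0"; cases "t < v"; cases "u < t") auto
  have int: "integrable (lborel \<Otimes>\<^sub>M lborel) (case_prod ?k)"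
  proof (rule integrableI_bounded_set[where A = "{0..u} \<times> {0..u}" and B = "M * (N * K)"])
    have "norm (?k t v) \<le> M * (N * K)" if "(t, v) \<in> {0..u} \<times> {0..u}" for t v
      using M N K that by (auto simp: abs_mult intro!: mult_mono')
    then show "AE x in lborel \<Otimes>\<^sub>M lborel. x \<in> {0..u} \<times> {0..u} \<longrightarrow> norm (case_prod ?k x) \<le> M * (N * K)"
      by (intro AE_I2) auto
    show "AE x in lborel \<Otimes>\<^sub>M lborel. x \<notin> {0..u} \<times> {0..u} \<longrightarrow> case_prod ?k x = 0"
    proof (intro AE_I2 impI)
      fix x :: "real \<times> real" assume "x \<notin> {0..u} \<times> {0..u}"
      then show "case_prod ?k x = 0" using z[of "fst x" "snd x"] by (cases x) (simp only: case_prod_conv fst_conv snd_conv not_False_eq_True)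
    qed
    show "emeasure (lborel \<Otimes>\<^sub>M lborel) ({0..u} \<times> {0..u}) < \<infinity>"
      by (subst lborel.emeasure_pair_measure_Times) (auto simp: ennreal_mult_less_top emeasure_lborel_Icc_eq)
  qed measurable
  have "conv f (conv g h) u = (LINT t|lborel. LINT v|lborel. ?k t v)"
    unfolding conv_def by simp
  also have "\<dots> = (LINT v|lborel. LINT t|lborel. ?k t v)"
    using lborel_pair.Fubini_integral[OF int] by simp
  also have "\<dots> = (LINT v|lborel. conv f g (u - v) * h v)"
  proof (rule Bochner_Integration.integral_cong[OF refl])
    fix v
    have "(LINT t|lborel. ?k t v) = \<bar>1\<bar> *\<^sub>R (LINT t|lborel. ?k (v + 1 * t) v)"
      by (rule lborel_integral_real_affine) simp
    also have "\<dots> = (LINT t|lborel. (f (u - v - t) * g t) * h v)"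
      by (simp add: algebra_simps)
    finally show "(LINT t|lborel. ?k t v) = conv f g (u - v) * h v"
      by (simp add: conv_def)
  qed
  finally show "conv (conv f g) h u = conv f (conv g h) u" by (simp add: conv_def)
qed

lemma conv_shift: "conv (\<lambda>t. f (t - a)) g u = conv f g (u - a)"
  unfolding conv_def by (simp add: algebra_simps)

lemma conv_add_left:
  assumes "causal f" "causal g" "causal h"
  shows "conv (\<lambda>t. f t + g t) h u = conv f h u + conv g h u"
  unfolding conv_def using assms by (simp add: distrib_right conv_integrable)

lemma conv_diff_left:
  assumes "causal f" "causal g" "causal h"
  shows "conv (\<lambda>t. f t - g t) h u = conv f h u - conv g h u"
  unfolding conv_def using assms by (simp add: left_diff_distrib conv_integrable)

lemma conv_add_right:
  assumes "causal f" "causal g" "causal h"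
  shows "conv h (\<lambda>t. f t + g t) u = conv h f u + conv h g u"
  unfolding conv_def using assms by (simp add: distrib_left conv_integrable)

lemma conv_diff_right:
  assumes "causal f" "causal g" "causal h"
  shows "conv h (\<lambda>t. f t - g t) u = conv h f u - conv h g u"
  unfolding conv_def using assms by (simp add: right_diff_distrib conv_integrable)

lemma conv_scale_right: "conv h (\<lambda>t. c * f t) u = c * conv h f u"
  unfolding conv_def by (simp add: mult.left_commute)

text \<open>Multiplication by the argument is a derivation of the convolution algebra. The delay equations
  of \<open>\<rho>\<close> and \<open>\<omega>\<close> describe \<open>u\<rho>'(u)\<close> and \<open>u\<omega>(u)\<close>, so this is how they are brought to bear on convolutions.\<close>

lemma conv_times_arg:
  assumes f: "causal f" and g: "causal g"
  shows "u * conv f g u = conv (\<lambda>t. t * f t) g u + conv f (\<lambda>t. t * g t) u"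
proof -
  have "conv (\<lambda>t. t * f t) g u + conv f (\<lambda>t. t * g t) u
      = (LINT v|lborel. (u - v) * f (u - v) * g v + f (u - v) * (v * g v))"
    unfolding conv_def
    using conv_integrable[OF causal_times_arg[OF f] g] conv_integrable[OF f causal_times_arg[OF g]]
    by (intro Bochner_Integration.integral_add[symmetric])
  also have "\<dots> = (LINT v|lborel. u * (f (u - v) * g v))"
    by (simp add: algebra_simps)
  finally show ?thesis by (simp add: conv_def)
qed

text \<open>Exponential weights are multiplicative, hence pass through a convolution; on the Laplace side
  this is the shift of the variable.\<close>

lemma conv_times_exp:
  "conv f g u * exp (c * u) = conv (\<lambda>t. f t * exp (c * t)) (\<lambda>t. g t * exp (c * t)) u"
proof -
  have "conv f g u * exp (c * u) = (LINT v|lborel. f (u - v) * g v * exp (c * u))"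
    unfolding conv_def by simp
  also have "\<dots> = (LINT v|lborel. (f (u - v) * exp (c * (u - v))) * (g v * exp (c * v)))"
  proof (rule Bochner_Integration.integral_cong[OF refl])
    fix v
    have "exp (c * u) = exp (c * (u - v)) * exp (c * v)" by (simp add: exp_add[symmetric] algebra_simps)
    then show "f (u - v) * g v * exp (c * u) = (f (u - v) * exp (c * (u - v))) * (g v * exp (c * v))"
      by simp
  qed
  finally show ?thesis by (simp add: conv_def)
qed

lemma conv_eq_integral:
  assumes f: "causal f" and g: "causal g"
  shows "conv f g u = integral {0..u} (\<lambda>v. f (u - v) * g v)"
    and "(\<lambda>v. f (u - v) * g v) integrable_on {0..u}"
proof -
  have *: "indicator {0..u} v *\<^sub>R (f (u - v) * g v) = f (u - v) * g v" for v
    using causal_neg[OF f, of "u - v"] causal_neg[OF g, of v]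
    by (cases "v < 0"; cases "v > u") (auto simp: indicator_def)
  have s: "set_integrable lborel {0..u} (\<lambda>v. f (u - v) * g v)"
    unfolding set_integrable_def * by (rule conv_integrable[OF f g])
  show "conv f g u = integral {0..u} (\<lambda>v. f (u - v) * g v)"
    using set_borel_integral_eq_integral(2)[OF s] unfolding set_lebesgue_integral_def * conv_def .
  show "(\<lambda>v. f (u - v) * g v) integrable_on {0..u}"
    using set_borel_integral_eq_integral(1)[OF s] .
qed

text \<open>Dominated convergence: far out, an integrable function sees only the limit of the kernel.\<close>

lemma conv_tendsto:
  assumes g: "integrable lborel g" and [measurable]: "k \<in> borel_measurable borel"
    and bd: "\<And>t. \<bar>k t\<bar> \<le> M" and k: "(k \<longlongrightarrow> l) at_top"
  shows "(conv k g \<longlongrightarrow> l * (LINT v|lborel. g v)) at_top"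
proof -
  note borel_measurable_integrable[OF g, measurable]
  have "((\<lambda>u. LINT v|lborel. k (u - v) * g v) \<longlongrightarrow> (LINT v|lborel. l * g v)) at_top"
  proof (rule integral_dominated_convergence_at_top[where w = "\<lambda>v. M * \<bar>g v\<bar>"])
    show "integrable lborel (\<lambda>v. M * \<bar>g v\<bar>)" using g by simp
    show "\<forall>\<^sub>F u in at_top. AE v in lborel. norm (k (u - v) * g v) \<le> M * \<bar>g v\<bar>"
      using bd by (auto simp: abs_mult intro!: always_eventually mult_right_mono)
    have "((\<lambda>u. k (u - v)) \<longlongrightarrow> l) at_top" for v
    proof (rule filterlim_compose[OF k])
      show "LIM u at_top. u - v :> at_top"
        using filterlim_tendsto_add_at_top[OF tendsto_const[of "-v"] filterlim_ident] by simp
    qed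
    then show "AE v in lborel. ((\<lambda>u. k (u - v) * g v) \<longlongrightarrow> l * g v) at_top"
      by (auto intro!: tendsto_mult_right always_eventually)
  qed measurable
  then show ?thesis unfolding conv_def [abs_def] by simp
qed


text \<open>Convolution with the unit step is integration from \<open>0\<close>.\<close>

definition step :: "real \<Rightarrow> real" where "step = indicator {0..}"

lemma step_simps [simp]: "t \<ge> 0 \<Longrightarrow> step t = 1" "t < 0 \<Longrightarrow> step t = 0"
  by (auto simp: step_def)

lemma step_measurable [measurable]: "step \<in> borel_measurable borel"
  unfolding step_def by measurable

lemma causal_step: "causal step"
  by (rule causal_boundedI[where M = 1]) auto

lemma conv_step_eq_integral:
  assumes f: "causal f" shows "conv step f u = integral {0..u} f"
  unfolding conv_eq_integral(1)[OF causal_step f] by (rule integral_cong) auto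

section \<open>The delay equations as convolution identities\<close>

lemma dickman_neg: "u < 0 \<Longrightarrow> dickman u = 0"
  and dickman_unit: "0 \<le> u \<Longrightarrow> u \<le> 1 \<Longrightarrow> dickman u = 1"
  and dickman_continuous: "continuous_on {0..} dickman"
  using is_dickman_dickman by (auto simp: is_dickman_def)

lemma dickman_deriv: "u > 1 \<Longrightarrow> (dickman has_real_derivative dickman' u) (at u)"
  using is_dickman_deriv[OF is_dickman_dickman, of u] deriv_dickman_gt_1[of u]
  by (simp add: dickman'_def)

lemma causal_dickman: "causal dickman"
proof (rule causalI)
  have "(\<lambda>t. indicator {0..} t *\<^sub>R dickman t) \<in> borel_measurable borel"
    by (intro borel_measurable_continuous_on_indicator dickman_continuous) auto
  also have "(\<lambda>t. indicator {0..} t *\<^sub>R dickman t) = dickman"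
    by (auto simp: fun_eq_iff indicator_def dickman_neg not_le)
  finally show "dickman \<in> borel_measurable borel" .
  fix T :: real
  have "compact (dickman ` {0..T})"
    by (intro compact_continuous_image continuous_on_subset[OF dickman_continuous]) auto
  then have "bounded (dickman ` {0..T})" by (rule compact_imp_bounded)
  then obtain M where "\<forall>x\<in>dickman ` {0..T}. norm x \<le> M" unfolding bounded_iff by blast
  then show "\<exists>M. \<forall>t. 0 \<le> t \<longrightarrow> t \<le> T \<longrightarrow> \<bar>dickman t\<bar> \<le> M"
    by (intro exI[of _ M]) auto
qed (rule dickman_neg)

text \<open>With the one-sided values of \<open>\<rho>'\<close> at \<open>0\<close> and \<open>1\<close>, the delay equation holds at every real \<open>u\<close>, without
  exceptional points.\<close>

lemma times_dickman': "u * dickman' u = - dickman (u - 1)"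
proof -
  consider "u < 0" | "u = 0" | "0 < u" "u < 1" | "u = 1" | "u > 1" by linarith
  then show ?thesis
  proof cases
    case 1
    have "(dickman has_real_derivative 0) (at u)"
      by (rule has_field_derivative_transform_within_open[OF DERIV_const, of "{..<0}" _ 0])
        (use 1 in \<open>auto simp: dickman_neg\<close>)
    then have "deriv dickman u = 0" by (rule DERIV_imp_deriv)
    with 1 show ?thesis by (simp add: dickman'_def dickman_neg)
  next
    case 3 then show ?thesis by (simp add: dickman'_def deriv_dickman_0_1 dickman_neg)
  next
    case 5 then show ?thesis by (simp add: dickman'_def deriv_dickman_gt_1)
  qed (auto simp: dickman'_0 dickman'_1 dickman_neg dickman_unit)
qed

lemma dickman'_eq: "dickman' u = - dickman (u - 1) / u"
  using times_dickman'[of u] by (cases "u = 0") (auto simp: dickman'_0 field_simps)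

lemma dickman'_lt_1: "u < 1 \<Longrightarrow> dickman' u = 0"
  by (simp add: dickman'_eq dickman_neg)

lemma causal_dickman': "causal dickman'"
proof (rule causalI)
  note causal_measurable[OF causal_dickman, measurable]
  show "dickman' \<in> borel_measurable borel"
    unfolding dickman'_eq [abs_def] by measurable
  fix T :: real
  obtain M where M: "M \<ge> 0" "\<And>t. t \<le> T \<Longrightarrow> \<bar>dickman t\<bar> \<le> M" using causal_bound[OF causal_dickman] by metis
  have "\<bar>dickman' t\<bar> \<le> M" if "t \<le> T" for t
  proof (cases "t < 1")
    case False
    have "\<bar>dickman' t\<bar> \<le> \<bar>dickman (t - 1)\<bar> / 1"
      unfolding dickman'_eq abs_divide using False by (intro frac_le) auto
    also have "\<dots> \<le> M" using M(2)[of "t - 1"] that by simp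
    finally show ?thesis .
  qed (use M(1) in \<open>simp add: dickman'_lt_1\<close>)
  then show "\<exists>M. \<forall>t. 0 \<le> t \<longrightarrow> t \<le> T \<longrightarrow> \<bar>dickman' t\<bar> \<le> M" by blast
qed (simp add: dickman'_lt_1)

lemma conv_step_dickman': "conv step dickman' u = dickman u - step u"
proof (cases "u < 0")
  case True
  then show ?thesis
    by (simp add: conv_neg causal_step causal_dickman' dickman_neg)
next
  case False
  have "(dickman' has_integral (dickman u - dickman 0)) {0..u}"
  proof (rule fundamental_theorem_of_calculus_interior_strong[where S = "{1}"])
    show "continuous_on {0..u} dickman" by (rule continuous_on_subset[OF dickman_continuous]) auto
    fix x assume x: "x \<in> {0<..<u} - {1}"
    show "(dickman has_vector_derivative dickman' x) (at x)"
    proof (cases "x > 1")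
      case True
      then show ?thesis using dickman_deriv has_real_derivative_iff_has_vector_derivative by blast
    next
      case False
      have "(dickman has_real_derivative 0) (at x)"
        by (rule has_field_derivative_transform_within_open[OF DERIV_const, of "{0<..<1}" _ 1])
          (use False x in \<open>auto simp: dickman_unit\<close>)
      then show ?thesis using False x
        by (simp add: dickman'_lt_1 has_real_derivative_iff_has_vector_derivative)
    qed
  qed (use False in auto)
  then show ?thesis
    using False by (simp add: conv_step_eq_integral[OF causal_dickman'] integral_unique dickman_unit)
qed

lemma buchstab_lt_1: "u < 1 \<Longrightarrow> buchstab u = 0"
  and buchstab_1_2: "1 \<le> u \<Longrightarrow> u \<le> 2 \<Longrightarrow> buchstab u = 1 / u"
  and buchstab_continuous: "continuous_on {1..} buchstab"
  and buchstab_deriv: "u > 2 \<Longrightarrow> ((\<lambda>t. t * buchstab t) has_real_derivative buchstab (u - 1)) (at u)"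
  using is_buchstab_buchstab by (auto simp: is_buchstab_def)

lemma causal_buchstab: "causal buchstab"
proof (rule causalI)
  have "(\<lambda>t. indicator {1..} t *\<^sub>R buchstab t) \<in> borel_measurable borel"
    by (intro borel_measurable_continuous_on_indicator buchstab_continuous) auto
  also have "(\<lambda>t. indicator {1..} t *\<^sub>R buchstab t) = buchstab"
    by (auto simp: fun_eq_iff indicator_def buchstab_lt_1 not_le)
  finally show "buchstab \<in> borel_measurable borel" .
  fix T :: real
  have "compact (buchstab ` {1..T})"
    by (intro compact_continuous_image continuous_on_subset[OF buchstab_continuous]) auto
  then have "bounded (buchstab ` {1..T})" by (rule compact_imp_bounded)
  then obtain M where "\<forall>x\<in>buchstab ` {1..T}. norm x \<le> M" unfolding bounded_iff by blast
  then have M: "\<bar>buchstab t\<bar> \<le> M" if "1 \<le> t" "t \<le> T" for t using that by auto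
  have "\<bar>buchstab t\<bar> \<le> max 0 M" if "t \<le> T" for t
    using M[of t] that by (cases "t < 1") (auto simp: buchstab_lt_1 le_max_iff_disj)
  then show "\<exists>M. \<forall>t. 0 \<le> t \<longrightarrow> t \<le> T \<longrightarrow> \<bar>buchstab t\<bar> \<le> M" by blast
qed (simp add: buchstab_lt_1)

text \<open>The delay equation of \<open>\<omega>\<close> in integrated form, covering also the initial range: for \<open>1 \<le> u \<le> 2\<close> the
  integral vanishes and the equation reads \<open>u\<omega>(u) = 1\<close>.\<close>

lemma times_buchstab: "u * buchstab u = step (u - 1) + conv step buchstab (u - 1)"
proof -
  have z: "conv step buchstab t = 0" if "t \<le> 1" for t
  proof -
    have "integral {0..t} buchstab = integral {0..t} (\<lambda>_. 0)"
      by (rule integral_spike[of "{1}"]) (use that in \<open>auto simp: buchstab_lt_1\<close>)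
    then show ?thesis by (simp add: conv_step_eq_integral causal_buchstab)
  qed
  consider "u < 1" | "1 \<le> u" "u \<le> 2" | "u > 2" by linarith
  then show ?thesis
  proof cases
    case 3
    have "((\<lambda>t. buchstab (t - 1)) has_integral (u * buchstab u - 2 * buchstab 2)) {2..u}"
    proof (rule fundamental_theorem_of_calculus_interior)
      show "continuous_on {2..u} (\<lambda>t. t * buchstab t)"
        by (intro continuous_intros continuous_on_subset[OF buchstab_continuous]) auto
      show "((\<lambda>t. t * buchstab t) has_vector_derivative buchstab (x - 1)) (at x)" if "x \<in> {2<..<u}" for x
        using buchstab_deriv[of x] that by (simp add: has_real_derivative_iff_has_vector_derivative)
    qed (use 3 in simp)
    then have I: "integral {2..u} (\<lambda>t. buchstab (t - 1)) = u * buchstab u - 1"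
      using buchstab_1_2[of 2] by (simp add: integral_unique)
    have "integral {2..u} (\<lambda>t. buchstab (t - 1)) = integral {1..u-1} buchstab"
      using integral_shift_Icc_real[of 2 u buchstab "-1"] by (simp add: o_def)
    also have "\<dots> = conv step buchstab (u - 1)"
    proof -
      have "buchstab integrable_on {0..u - 1}"
        using conv_eq_integral(2)[OF causal_step causal_buchstab, of "u - 1"]
        by (rule integrable_eq) auto
      then have "integral {0..1} buchstab + integral {1..u-1} buchstab = integral {0..u - 1} buchstab"
        using 3 by (intro Henstock_Kurzweil_Integration.integral_combine) auto
      then show ?thesis using z[of 1] by (simp add: conv_step_eq_integral causal_buchstab)
    qed
    finally show ?thesis using I 3 by simp
  qed (auto simp: z buchstab_lt_1 buchstab_1_2)
qed

text \<open>The resolvent identity \<open>(\<delta> + \<rho>')*(\<delta> + \<omega>) = \<delta>\<close>. Multiply \<open>\<rho>' + \<omega> + \<rho>'*\<omega>\<close> by \<open>u\<close>. With \<open>\<tau>\<close> for the shift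
  by \<open>1\<close> and \<open>e\<close> for the unit step, the delay equations are \<open>u\<rho>' = -\<tau>\<rho>\<close> and \<open>u\<omega> = \<tau>(e + e*\<omega>)\<close>, and
  \<open>e*\<rho>' = \<rho> - e\<close>. The derivation rule then turns it into
  \<open>\<tau>(-\<rho> + (e + e*\<omega>) - \<rho>*\<omega> + (\<rho> - e) + (\<rho> - e)*\<omega>) = 0\<close>.\<close>

lemma dickman'_buchstab_inverse:
  "dickman' u + buchstab u + conv dickman' buchstab u = 0"
proof (cases "u = 0")
  case True
  have "conv dickman' buchstab 0 = 0"
    using conv_eq_integral(1)[OF causal_dickman' causal_buchstab, of 0] by simp
  then show ?thesis using True by (simp add: dickman'_lt_1 buchstab_lt_1)
next
  case False
  note c = causal_step causal_dickman causal_dickman' causal_buchstab causal_conv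
  let ?b = "\<lambda>t. step t + conv step buchstab t"
  have cb: "causal ?b" by (intro causal_add c)
  have 1: "conv (\<lambda>t. t * dickman' t) buchstab u = - conv dickman buchstab (u - 1)"
    unfolding times_dickman' using conv_shift[of dickman 1 buchstab u]
    by (simp add: conv_def)
  have "conv dickman' (\<lambda>t. t * buchstab t) u = conv (\<lambda>t. ?b (t - 1)) dickman' u"
    unfolding times_buchstab by (simp add: conv_commute)
  also have "\<dots> = conv ?b dickman' (u - 1)" by (rule conv_shift)
  also have "\<dots> = conv step dickman' (u - 1) + conv (conv step buchstab) dickman' (u - 1)"
    by (intro conv_add_left c)
  also have "conv (conv step buchstab) dickman' = conv buchstab (conv step dickman')"
    using conv_assoc[of buchstab step dickman'] c by (metis conv_commute)
  also have "\<dots> = conv (\<lambda>t. dickman t - step t) buchstab"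
    by (subst conv_commute) (simp add: conv_step_dickman' [abs_def])
  also have "conv (\<lambda>t. dickman t - step t) buchstab (u - 1)
      = conv dickman buchstab (u - 1) - conv step buchstab (u - 1)"
    by (intro conv_diff_left c)
  finally have 2: "conv dickman' (\<lambda>t. t * buchstab t) u = dickman (u - 1) - step (u - 1)
     + (conv dickman buchstab (u - 1) - conv step buchstab (u - 1))"
    by (simp add: conv_step_dickman')
  have "u * (dickman' u + buchstab u + conv dickman' buchstab u) = 0"
    unfolding distrib_left conv_times_arg[OF causal_dickman' causal_buchstab] 1 2
    by (simp add: times_dickman' times_buchstab)
  with False show ?thesis by simp
qed

text \<open>The integral of the previous identity.\<close>

lemma dickman_buchstab:
  "dickman u + conv buchstab dickman u = step u"
proof -
  note c = causal_step causal_dickman causal_dickman' causal_buchstab causal_conv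
  have "conv step (\<lambda>_. 0) u = 0" by (simp add: conv_def)
  then have "0 = conv step (\<lambda>t. dickman' t + buchstab t + conv dickman' buchstab t) u"
    unfolding dickman'_buchstab_inverse by simp
  also have "\<dots> = conv step dickman' u + conv step buchstab u + conv step (conv dickman' buchstab) u"
    by (subst conv_add_right; (intro causal_add c)?; subst conv_add_right; (intro c)?; simp)
  also have "conv step (conv dickman' buchstab) = conv (\<lambda>t. dickman t - step t) buchstab"
    by (subst conv_assoc[symmetric]) (auto intro: c simp: conv_step_dickman' [abs_def])
  also have "conv (\<lambda>t. dickman t - step t) buchstab u = conv dickman buchstab u - conv step buchstab u"
    by (intro conv_diff_left c)
  finally show ?thesis by (simp add: conv_step_dickman' conv_commute[of dickman])
qed

text \<open>This is the familiar \<open>u\<rho>(u) = \<integral>\<^bsub>u-1\<^esub>\<^bsup>u\<^esup> \<rho>\<close>. It follows by the derivation rule from \<open>\<rho> = e + e*\<rho>'\<close>, the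
  delay equation and \<open>u e = e*e\<close>.\<close>

lemma times_dickman:
  "u * dickman u = conv (\<lambda>t. step t - step (t - 1)) dickman u"
proof -
  note c = causal_step causal_dickman causal_dickman' causal_conv causal_times_arg
  have s: "t * step t = conv step step t" for t
  proof (cases "t \<ge> 0")
    case True
    have "integral {0..t} step = integral {0..t} (\<lambda>_. 1)" by (rule integral_cong) auto
    with True show ?thesis by (simp add: conv_step_eq_integral[OF causal_step])
  qed (simp add: conv_neg causal_step)
  have d: "dickman t = step t + conv step dickman' t" for t by (simp add: conv_step_dickman')
  have "u * dickman u = u * step u + u * conv step dickman' u"
    by (simp add: conv_step_dickman' algebra_simps)
  also have "u * conv step dickman' u = conv (conv step step) dickman' u + conv step (\<lambda>t. t * dickman' t) u"
    by (subst conv_times_arg) (auto intro: c simp: s[abs_def])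
  also have "conv (conv step step) dickman' u = conv step (\<lambda>t. dickman t - step t) u"
    by (subst conv_assoc) (auto intro: c simp: conv_step_dickman' [abs_def])
  also have "\<dots> = conv step dickman u - conv step step u" by (intro conv_diff_right c)
  also have "conv step (\<lambda>t. t * dickman' t) u = - conv step dickman (u - 1)"
  proof -
    have "conv step (\<lambda>t. t * dickman' t) u = - conv step (\<lambda>t. dickman (t - 1)) u"
      unfolding times_dickman' by (simp add: conv_def)
    then show ?thesis using conv_shift[of dickman 1 step u] by (metis conv_commute)
  qed
  also have "conv step dickman (u - 1) = conv (\<lambda>t. step (t - 1)) dickman u"
    by (simp add: conv_shift)
  finally show ?thesis using s
    by (subst conv_diff_left) (auto intro!: c causal_shift)
qed


section \<open>Decay faster than every exponential\<close>

text \<open>If the value at \<open>u\<close> is at most \<open>1/u\<close> times the supremum over \<open>[u - 1, u]\<close>, then the weighted function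
  \<open>\<bar>h(u)\<bar> e\<^sup>B\<^sup>u\<close> cannot reach a new maximum beyond \<open>u = e\<^sup>B\<close>: stepping back by at most \<open>1\<close> costs a factor
  \<open>e\<^sup>B\<close>, whereas the hypothesis gains a factor \<open>u\<close>.\<close>

lemma delay_decay:
  fixes h :: "real \<Rightarrow> real"
  assumes a: "a \<ge> 0" and cont: "continuous_on {a..} h"
    and le: "\<And>u M. u \<ge> a + 1 \<Longrightarrow> (\<And>t. u - 1 \<le> t \<Longrightarrow> t \<le> u \<Longrightarrow> \<bar>h t\<bar> \<le> M) \<Longrightarrow> u * \<bar>h u\<bar> \<le> M"
    and B: "B \<ge> 0"
  obtains K where "K \<ge> 0" "\<And>u. u \<ge> a \<Longrightarrow> \<bar>h u\<bar> \<le> K * exp (- B * u)"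
proof -
  define g where "g u = \<bar>h u\<bar> * exp (B * u)" for u
  have cg: "continuous_on {a..u} g" for u
    unfolding g_def by (intro continuous_intros continuous_on_subset[OF cont]) auto
  define N where "N = max (a + 1) (exp B)"
  have "\<exists>s\<in>{a..N}. \<forall>t\<in>{a..N}. g t \<le> g s"
    by (rule continuous_attains_sup[OF _ _ cg]) (auto simp: N_def)
  then obtain s where s: "\<And>t. t \<in> {a..N} \<Longrightarrow> g t \<le> g s" by blast
  have g0: "g t \<ge> 0" for t by (simp add: g_def)
  have bound: "g u \<le> g s" if "u \<ge> a" for u
  proof (rule ccontr)
    assume "\<not> g u \<le> g s"
    have "\<exists>t\<in>{a..u}. \<forall>r\<in>{a..u}. g r \<le> g t"
      by (rule continuous_attains_sup[OF _ _ cg]) (use that in auto)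
    then obtain t where t: "t \<in> {a..u}" "\<And>r. r \<in> {a..u} \<Longrightarrow> g r \<le> g t" by blast
    have "g t > g s" using t(2)[of u] that \<open>\<not> g u \<le> g s\<close> by simp
    \<comment> \<open>the maximum over \<open>[a, u]\<close> exceeds the one over \<open>[a, N]\<close>, so it sits beyond \<open>N \<ge> e\<^sup>B\<close>\<close>
    then have tN: "t > N" using s[of t] t(1) by force
    have "t * \<bar>h t\<bar> \<le> g t * exp (- B * (t - 1))"
    proof (rule le)
      show "t \<ge> a + 1" using tN by (simp add: N_def)
      fix r assume r: "t - 1 \<le> r" "r \<le> t"
      have "\<bar>h r\<bar> = g r * exp (- B * r)" by (simp add: g_def exp_minus field_simps)
      also have "\<dots> \<le> g t * exp (- B * (t - 1))"
        using r t tN g0 B by (intro mult_mono t(2)) (auto simp: N_def mult_left_mono)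
      finally show "\<bar>h r\<bar> \<le> g t * exp (- B * (t - 1))" .
    qed
    also have "\<dots> = exp B * \<bar>h t\<bar>"
      by (simp add: g_def exp_minus algebra_simps exp_diff)
    finally have "t * \<bar>h t\<bar> \<le> exp B * \<bar>h t\<bar>" .
    moreover have "g t > 0" using \<open>g t > g s\<close> g0[of s] by linarith
    then have "h t \<noteq> 0" by (auto simp: g_def)
    ultimately have "t \<le> exp B" by simp
    then show False using tN by (simp add: N_def)
  qed
  have "\<bar>h u\<bar> \<le> g s * exp (- B * u)" if "u \<ge> a" for u
    using bound[OF that] by (simp add: g_def exp_minus field_simps)
  then show ?thesis using that g0 by blast
qed

definition unit_window :: "real \<Rightarrow> real" where
  "unit_window t = step t - step (t - 1)"

lemma unit_window_eq: "unit_window t = indicator {0..<1} t"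
  by (auto simp: unit_window_def indicator_def step_def)

lemma causal_unit_window: "causal unit_window"
  unfolding unit_window_def [abs_def] by (intro causal_diff causal_shift causal_step) auto

lemma dickman_decay:
  assumes "B \<ge> 0"
  obtains K where "K \<ge> 0" "\<And>u. u \<ge> 0 \<Longrightarrow> \<bar>dickman u\<bar> \<le> K * exp (- B * u)"
proof (rule delay_decay[OF order_refl dickman_continuous _ assms])
  fix u M :: real assume u: "u \<ge> 0 + 1" and M: "\<And>t. u - 1 \<le> t \<Longrightarrow> t \<le> u \<Longrightarrow> \<bar>dickman t\<bar> \<le> M"
  have "u * \<bar>dickman u\<bar> = \<bar>u * dickman u\<bar>" using u by (simp add: abs_mult)
  also have "\<dots> = \<bar>conv unit_window dickman u\<bar>"
    by (simp only: times_dickman unit_window_def [abs_def])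
  also have "\<dots> \<le> (LINT v|lborel. M * indicator {u - 1..u} v)"
    unfolding conv_def
  proof (rule integral_abs_bound[THEN order_trans], rule integral_mono)
    show "integrable lborel (\<lambda>v. \<bar>unit_window (u - v) * dickman v\<bar>)"
      by (intro integrable_abs conv_integrable causal_unit_window causal_dickman)
    show "integrable lborel (\<lambda>v. M * indicator {u - 1..u} v)"
      by (intro integrable_mult_right integrable_real_indicator) auto
    show "\<bar>unit_window (u - v) * dickman v\<bar> \<le> M * indicator {u - 1..u} v" for v
      using M[of v] by (auto simp: unit_window_eq indicator_def)
  qed
  also have "\<dots> = M" by simp
  finally show "u * \<bar>dickman u\<bar> \<le> M" .
qed (use that in blast)

lemma exp_tail_integral:
  fixes a c :: real
  assumes c: "c > 0"
  shows "has_bochner_integral lborel (\<lambda>t. indicator {a..} t * exp (- c * t)) (exp (- c * a) / c)"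
proof -
  have "(\<integral>\<^sup>+t. ennreal (exp (- c * t)) * indicator {a..} t \<partial>lborel) = ennreal (0 - (- exp (- c * a) / c))"
  proof (rule nn_integral_FTC_atLeast)
    show "((\<lambda>t. - exp (- c * t) / c) has_real_derivative exp (- c * t)) (at t)" for t
      using c by (auto intro!: derivative_eq_intros)
    have "LIM t at_top. - c * t :> at_bot"
      using c by (intro filterlim_tendsto_neg_mult_at_bot[OF tendsto_const] filterlim_ident) auto
    then have "((\<lambda>t. exp (- c * t)) \<longlongrightarrow> 0) at_top"
      by (rule filterlim_compose[OF exp_at_bot])
    then have "((\<lambda>t. - exp (- c * t) / c) \<longlongrightarrow> - 0 / c) at_top"
      using c by (intro tendsto_intros) auto
    then show "((\<lambda>t. - exp (- c * t) / c) \<longlongrightarrow> 0) at_top" by simp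
  qed auto
  moreover have "(\<integral>\<^sup>+t. ennreal (indicator {a..} t * exp (- c * t)) \<partial>lborel)
      = (\<integral>\<^sup>+t. ennreal (exp (- c * t)) * indicator {a..} t \<partial>lborel)"
    by (intro nn_integral_cong) (auto simp: indicator_def)
  ultimately have "(\<integral>\<^sup>+t. ennreal (indicator {a..} t * exp (- c * t)) \<partial>lborel) = ennreal (exp (- c * a) / c)"
    by simp
  then show ?thesis
    using c by (intro has_bochner_integral_nn_integral) auto
qed

lemma exp_tail_integrable: "c > 0 \<Longrightarrow> integrable lborel (\<lambda>t :: real. indicator {a..} t * exp (- c * t))"
  using exp_tail_integral[of c a] by (auto simp: has_bochner_integral_iff)

lemma integrable_exp_bound:
  assumes f: "causal f" and c: "c > 0" and le: "\<And>t. t \<ge> 0 \<Longrightarrow> \<bar>f t\<bar> \<le> K * exp (- c * t)"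
  shows "integrable lborel f"
proof (rule Bochner_Integration.integrable_bound)
  show "integrable lborel (\<lambda>t. K * (indicator {0..} t * exp (- c * t)))"
    by (intro integrable_mult_right exp_tail_integrable c)
  show "f \<in> borel_measurable lborel" using causal_measurable[OF f] by simp
  have "norm (f t) \<le> norm (K * (indicator {0..} t * exp (- c * t)))" for t
    using le[of t] causal_neg[OF f, of t] by (cases "t \<ge> 0") (auto simp: indicator_def intro: order_trans[OF _ abs_ge_self])
  then show "AE t in lborel. norm (f t) \<le> norm (K * (indicator {0..} t * exp (- c * t)))" by simp
qed

text \<open>Every exponential weight is allowed, of either sign: the Laplace transform of \<open>\<rho>\<close> is entire.\<close>

lemma dickman_exp_integrable: "integrable lborel (\<lambda>t. dickman t * exp (c * t))"
proof -
  obtain K where K: "\<And>u. u \<ge> 0 \<Longrightarrow> \<bar>dickman u\<bar> \<le> K * exp (- (\<bar>c\<bar> + 1) * u)"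
    using dickman_decay[of "\<bar>c\<bar> + 1"] by auto
  show ?thesis
  proof (rule integrable_exp_bound[where c = 1 and K = K])
    show "causal (\<lambda>t. dickman t * exp (c * t))" by (rule causal_times_exp[OF causal_dickman])
    fix t :: real assume t: "t \<ge> 0"
    have "\<bar>dickman t * exp (c * t)\<bar> \<le> (K * exp (- (\<bar>c\<bar> + 1) * t)) * exp (\<bar>c\<bar> * t)"
      unfolding abs_mult using K[OF t] t by (intro mult_mono) (auto simp: mult_right_mono)
    also have "\<dots> = K * exp (- 1 * t)" by (simp add: exp_add[symmetric] algebra_simps)
    finally show "\<bar>dickman t * exp (c * t)\<bar> \<le> K * exp (- 1 * t)" .
  qed auto
qed

lemma conv_step_tendsto:
  assumes "integrable lborel g"
  shows "(conv step g \<longlongrightarrow> (LINT v|lborel. g v)) at_top"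
proof -
  have "(step \<longlongrightarrow> 1) at_top"
    by (rule tendsto_eventually) (auto intro: eventually_at_top_linorderI[of 0])
  moreover have "\<bar>step t\<bar> \<le> 1" for t by (auto simp: step_def indicator_def)
  ultimately show ?thesis using conv_tendsto[OF assms step_measurable, of 1 1] by simp
qed

section \<open>The integral of Dickman's function\<close>

text \<open>Fubini's theorem, obtained inside the convolution algebra: the integral of a function is the limit
  of its convolution with the unit step, and convolution is associative.\<close>

lemma integral_conv:
  assumes f: "causal f" "integrable lborel f" and g: "causal g" "integrable lborel g"
    and fg: "integrable lborel (conv f g)"
  shows "(LINT v|lborel. conv f g v) = (LINT v|lborel. f v) * (LINT v|lborel. g v)"
proof -
  have "(conv step (conv f g) \<longlongrightarrow> (LINT v|lborel. conv f g v)) at_top"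
    by (rule conv_step_tendsto[OF fg])
  moreover have "conv step (conv f g) = conv (conv step f) g"
    by (rule conv_assoc[symmetric]) (intro causal_step f g)+
  moreover have "(conv (conv step f) g \<longlongrightarrow> (LINT v|lborel. f v) * (LINT v|lborel. g v)) at_top"
  proof (rule conv_tendsto[OF g(2)])
    show "conv step f \<in> borel_measurable borel"
      by (intro causal_measurable causal_conv causal_step f)
    show "(conv step f \<longlongrightarrow> (LINT v|lborel. f v)) at_top"
      by (rule conv_step_tendsto[OF f(2)])
    show "\<bar>conv step f t\<bar> \<le> (LINT v|lborel. \<bar>f v\<bar>)" for t
      unfolding conv_def
    proof (rule integral_abs_bound[THEN order_trans], rule integral_mono)
      show "integrable lborel (\<lambda>v. \<bar>step (t - v) * f v\<bar>)"
        by (intro integrable_abs conv_integrable causal_step f)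
    qed (use f in \<open>auto simp: step_def indicator_def\<close>)
  qed
  ultimately show ?thesis by (metis tendsto_unique trivial_limit_at_top_linorder)
qed

definition dickman_laplace :: "real \<Rightarrow> real" where
  "dickman_laplace s = (LINT u|lborel. dickman u * exp (- s * u))"

lemma exp_remainder_bound: "\<bar>exp z - 1 - z\<bar> \<le> z\<^sup>2 * exp \<bar>z\<bar>" for z :: real
proof -
  have 1: "exp z - 1 - z \<ge> 0" using exp_ge_add_one_self[of z] by linarith
  have "exp z * exp (- z) \<ge> exp z * (1 - z)"
    using exp_ge_add_one_self[of "- z"] by (intro mult_left_mono) auto
  then have e: "exp z - 1 \<le> z * exp z" by (simp add: exp_minus algebra_simps)
  have "exp z - 1 - z \<le> z * (exp z - 1)" using e by (simp add: algebra_simps)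
  also have "\<dots> \<le> z\<^sup>2 * exp \<bar>z\<bar>"
  proof (cases "z \<ge> 0")
    case True
    then have "z * (exp z - 1) \<le> z * (z * exp z)" using e by (intro mult_left_mono)
    with True show ?thesis by (simp add: power2_eq_square)
  next
    case False
    have "z \<le> exp z - 1" "z \<le> 0" using False 1 by linarith+
    then have "z * (exp z - 1) \<le> z * z" by (rule mult_left_mono_neg)
    also have "\<dots> \<le> (z * z) * exp \<bar>z\<bar>" using mult_left_mono[of 1 "exp \<bar>z\<bar>" "z * z"] by simp
    finally show ?thesis by (simp add: power2_eq_square)
  qed
  finally show ?thesis using 1 by simp
qed

lemma exp_gt_self: "u < exp u" for u :: real
  using exp_ge_add_one_self[of u] by linarith

text \<open>Differentiation under the integral sign. The difference quotient differs from its limit by at most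
  \<open>\<bar>h\<bar>\<close> times the integral of \<open>u\<^sup>2 \<bar>\<rho>(u)\<bar> e\<^sup>u\<close>. The derivative is two-sided also at \<open>s = 0\<close>, which gives
  continuity there.\<close>

lemma dickman_laplace_deriv:
  assumes s: "s \<ge> 0"
  shows "(dickman_laplace has_real_derivative - (LINT u|lborel. u * dickman u * exp (- s * u))) (at s)"
proof -
  let ?G = "LINT u|lborel. u * dickman u * exp (- s * u)"
  have dom: "integrable lborel (\<lambda>u. u\<^sup>2 * (dickman u * exp u))"
  proof -
    obtain K where K: "K \<ge> 0" "\<And>u. u \<ge> 0 \<Longrightarrow> \<bar>dickman u\<bar> \<le> K * exp (- 3 * u)"
      using dickman_decay[of 3] by auto
    show ?thesis
    proof (rule integrable_exp_bound[where c = 1 and K = "2 * K"])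
      have "causal (\<lambda>u. u * (u * (dickman u * exp (1 * u))))"
        by (intro causal_times_arg causal_times_exp causal_dickman)
      then show "causal (\<lambda>u. u\<^sup>2 * (dickman u * exp u))"
        by (simp add: power2_eq_square mult.assoc)
      fix t :: real assume t: "t \<ge> 0"
      have "t\<^sup>2 \<le> 2 * exp t" using exp_lower_Taylor_quadratic[OF t] t by simp
      then have "\<bar>t\<^sup>2 * (dickman t * exp t)\<bar> \<le> (2 * exp t) * ((K * exp (- 3 * t)) * exp t)"
        unfolding abs_mult using K(2)[OF t] t by (intro mult_mono) auto
      also have "\<dots> = 2 * K * exp (- 1 * t)" by (simp add: exp_add[symmetric] algebra_simps)
      finally show "\<bar>t\<^sup>2 * (dickman t * exp t)\<bar> \<le> 2 * K * exp (- 1 * t)" .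
    qed auto
  qed
  let ?K = "LINT u|lborel. u\<^sup>2 * \<bar>dickman u * exp u\<bar>"
  have dom': "integrable lborel (\<lambda>u. u\<^sup>2 * \<bar>dickman u * exp u\<bar>)"
    using integrable_abs[OF dom] by (simp add: abs_mult)
  have int: "integrable lborel (\<lambda>u. dickman u * exp (- r * u))" for r
    using dickman_exp_integrable[of "-r"] by simp
  have intG: "integrable lborel (\<lambda>u. u * dickman u * exp (- s * u))"
  proof (rule Bochner_Integration.integrable_bound)
    show "integrable lborel (\<lambda>u. dickman u * exp (1 * u))" by (rule dickman_exp_integrable)
    show "(\<lambda>u. u * dickman u * exp (- s * u)) \<in> borel_measurable lborel"
      using causal_measurable[OF causal_dickman] by measurable
    have "norm (u * dickman u * exp (- s * u)) \<le> norm (dickman u * exp (1 * u))" for u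
    proof (cases "u \<ge> 0")
      case True
      have "u * exp (- s * u) \<le> exp u * 1"
        using True s less_imp_le[OF exp_gt_self[of u]] by (intro mult_mono) auto
      then have "\<bar>dickman u\<bar> * (u * exp (- s * u)) \<le> \<bar>dickman u\<bar> * exp u"
        by (intro mult_left_mono) auto
      with True show ?thesis by (simp add: abs_mult mult.assoc mult.left_commute)
    qed (simp add: dickman_neg)
    then show "AE u in lborel. norm (u * dickman u * exp (- s * u)) \<le> norm (dickman u * exp (1 * u))" by simp
  qed
  have main: "\<bar>(dickman_laplace (s + h) - dickman_laplace s) / h - - ?G\<bar> \<le> \<bar>h\<bar> * ?K"
    if h: "h \<noteq> 0" "\<bar>h\<bar> < 1" for h
  proof -
    let ?d = "\<lambda>u. dickman u * exp (- (s + h) * u) - dickman u * exp (- s * u) + h * (u * dickman u * exp (- s * u))"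
    have intd: "integrable lborel ?d"
      by (intro Bochner_Integration.integrable_add Bochner_Integration.integrable_diff int integrable_mult_right intG)
    have eq: "dickman_laplace (s + h) - dickman_laplace s + h * ?G = (LINT u|lborel. ?d u)"
      unfolding dickman_laplace_def
      by (simp only: Bochner_Integration.integral_add[OF Bochner_Integration.integrable_diff[OF int int]
            integrable_mult_right[OF intG]] Bochner_Integration.integral_diff[OF int int] integral_mult_right_zero)
    have "\<bar>LINT u|lborel. ?d u\<bar> \<le> (LINT u|lborel. h\<^sup>2 * (u\<^sup>2 * \<bar>dickman u * exp u\<bar>))"
    proof (rule integral_abs_bound[THEN order_trans], rule integral_mono)
      show "integrable lborel (\<lambda>u. \<bar>?d u\<bar>)" using intd by (rule integrable_abs)
      show "integrable lborel (\<lambda>u. h\<^sup>2 * (u\<^sup>2 * \<bar>dickman u * exp u\<bar>))"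
        using dom' by (rule integrable_mult_right)
      fix u :: real
      show "\<bar>?d u\<bar> \<le> h\<^sup>2 * (u\<^sup>2 * \<bar>dickman u * exp u\<bar>)"
      proof (cases "u \<ge> 0")
        case True
        have "exp (- (s + h) * u) = exp (- s * u) * exp (- (h * u))"
          by (simp add: exp_add[symmetric] algebra_simps)
        then have "?d u = dickman u * exp (- s * u) * (exp (- (h * u)) - 1 - (- (h * u)))"
          by (simp add: algebra_simps)
        then have "\<bar>?d u\<bar> = \<bar>dickman u\<bar> * exp (- s * u) * \<bar>exp (- (h * u)) - 1 - (- (h * u))\<bar>"
          by (simp only: abs_mult abs_exp_cancel)
        also have "\<dots> \<le> \<bar>dickman u\<bar> * 1 * ((- (h * u))\<^sup>2 * exp \<bar>- (h * u)\<bar>)"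
          using True s by (intro mult_mono exp_remainder_bound) auto
        also have "\<dots> \<le> \<bar>dickman u\<bar> * 1 * ((- (h * u))\<^sup>2 * exp u)"
        proof -
          have "\<bar>- (h * u)\<bar> \<le> 1 * u"
            using True h by (simp only: abs_minus_cancel abs_mult) (intro mult_mono, auto)
          then show ?thesis by (intro mult_left_mono) auto
        qed
        finally show ?thesis by (simp add: abs_mult power_mult_distrib algebra_simps)
      qed (simp add: dickman_neg)
    qed
    also have "\<dots> = h\<^sup>2 * ?K" by simp
    finally have "\<bar>dickman_laplace (s + h) - dickman_laplace s + h * ?G\<bar> / \<bar>h\<bar> \<le> h\<^sup>2 * ?K / \<bar>h\<bar>"
      unfolding eq by (rule divide_right_mono) simp
    moreover have "(dickman_laplace (s + h) - dickman_laplace s) / h - - ?G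
       = (dickman_laplace (s + h) - dickman_laplace s + h * ?G) / h" using h by (simp add: field_simps)
    moreover have "h\<^sup>2 * ?K / \<bar>h\<bar> = \<bar>h\<bar> * ?K" using h by (simp add: power2_eq_square field_simps abs_if)
    ultimately show ?thesis by (simp only: abs_divide)
  qed
  have "((\<lambda>h. (dickman_laplace (s + h) - dickman_laplace s) / h) \<longlongrightarrow> - ?G) (at 0)"
  proof (rule LIM_zero_cancel, rule Lim_null_comparison)
    show "\<forall>\<^sub>F h in at 0. norm ((dickman_laplace (s + h) - dickman_laplace s) / h - - ?G) \<le> \<bar>h\<bar> * ?K"
      unfolding eventually_at using main by (intro exI[of _ 1]) (auto simp: dist_real_def)
    have "((\<lambda>h. \<bar>h\<bar> * ?K) \<longlongrightarrow> \<bar>0\<bar> * ?K) (at 0)" by (intro tendsto_intros)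
    then show "((\<lambda>h. \<bar>h\<bar> * ?K) \<longlongrightarrow> 0) (at 0)" by simp
  qed
  then show ?thesis by (simp add: DERIV_def)
qed

text \<open>The transform of \<open>u\<rho>(u)\<close> factors because \<open>u\<rho>\<close> is the convolution of \<open>\<rho>\<close> with the indicator of \<open>[0,1)\<close>,
  whose transform is \<open>(1 - e\<^sup>-\<^sup>s)/s\<close>.\<close>

lemma dickman_laplace_deriv_eq:
  assumes s: "s > 0"
  shows "(LINT u|lborel. u * dickman u * exp (- s * u)) = (1 - exp (- s)) / s * dickman_laplace s"
proof -
  let ?w = "\<lambda>t. unit_window t * exp (- s * t)" and ?r = "\<lambda>t. dickman t * exp (- s * t)"
  have cw: "causal ?w" and cr: "causal ?r"
    by (intro causal_times_exp causal_unit_window causal_dickman)+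
  have eq: "conv ?w ?r u = u * dickman u * exp (- s * u)" for u
    by (simp only: conv_times_exp[symmetric] times_dickman unit_window_def[symmetric])
  have w: "?w = (\<lambda>t. indicator {0..} t * exp (- s * t) - indicator {1..} t * exp (- s * t))"
    by (auto simp: fun_eq_iff unit_window_eq indicator_def)
  have intw: "has_bochner_integral lborel ?w (exp (- s * 0) / s - exp (- s * 1) / s)"
    unfolding w by (intro has_bochner_integral_diff exp_tail_integral s)
  have int: "integrable lborel (conv ?w ?r)"
  proof (rule Bochner_Integration.integrable_bound)
    show "integrable lborel (\<lambda>u. dickman u * exp (1 * u))" by (rule dickman_exp_integrable)
    show "conv ?w ?r \<in> borel_measurable lborel"
      using causal_measurable[OF causal_conv[OF cw cr]] by simp
    have "norm (conv ?w ?r u) \<le> norm (dickman u * exp (1 * u))" for u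
    proof (cases "u \<ge> 0")
      case True
      have "u * exp (- s * u) \<le> exp u * 1"
        using True s less_imp_le[OF exp_gt_self[of u]] by (intro mult_mono) auto
      then have "\<bar>dickman u\<bar> * (u * exp (- s * u)) \<le> \<bar>dickman u\<bar> * exp u"
        by (intro mult_left_mono) auto
      with True show ?thesis unfolding eq by (simp add: abs_mult mult.assoc mult.left_commute)
    next
      case False
      then show ?thesis unfolding eq by (simp add: dickman_neg)
    qed
    then show "AE u in lborel. norm (conv ?w ?r u) \<le> norm (dickman u * exp (1 * u))" by simp
  qed
  have "(LINT u|lborel. conv ?w ?r u) = (LINT u|lborel. ?w u) * (LINT u|lborel. ?r u)"
    by (rule integral_conv[OF cw _ cr _ int])
      (use intw dickman_exp_integrable[of "-s"] in \<open>auto simp: has_bochner_integral_iff\<close>)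
  moreover have "(LINT u|lborel. ?w u) = (1 - exp (- s)) / s"
    using intw by (simp add: has_bochner_integral_iff diff_divide_distrib)
  ultimately show ?thesis unfolding eq dickman_laplace_def by simp
qed

text \<open>For large \<open>s\<close> only the initial value \<open>\<rho>(0) = 1\<close> counts: as \<open>\<rho> = 1\<close> on \<open>[0,1]\<close>, replacing \<open>\<rho>\<close> by the unit
  step changes \<open>s F(s)\<close> by \<open>O(e\<^sup>-\<^sup>s)\<close> only.\<close>

lemma dickman_laplace_at_top: "((\<lambda>s. s * dickman_laplace s) \<longlongrightarrow> 1) at_top"
proof -
  obtain K where K: "K \<ge> 0" "\<And>u. u \<ge> 0 \<Longrightarrow> \<bar>dickman u\<bar> \<le> K * exp (- 0 * u)"
    using dickman_decay[of 0] by auto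
  have le: "\<bar>s * dickman_laplace s - 1\<bar> \<le> (K + 1) * exp (- s)" if s: "s > 0" for s
  proof -
    have i0: "has_bochner_integral lborel (\<lambda>t. indicator {0..} t * exp (- s * t)) (exp (- s * 0) / s)"
      and i1: "has_bochner_integral lborel (\<lambda>t. indicator {1..} t * exp (- s * t)) (exp (- s * 1) / s)"
      by (intro exp_tail_integral s)+
    have int: "integrable lborel (\<lambda>u. dickman u * exp (- s * u))"
      using dickman_exp_integrable[of "-s"] by simp
    let ?d = "\<lambda>u. dickman u * exp (- s * u) - indicator {0..} u * exp (- s * u)"
    have intd: "integrable lborel ?d"
      using int i0 by (auto simp: has_bochner_integral_iff)
    have "dickman_laplace s - 1 / s = (LINT u|lborel. ?d u)"
      unfolding dickman_laplace_def using int i0 by (simp add: has_bochner_integral_iff)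
    also have "\<bar>\<dots>\<bar> \<le> (LINT u|lborel. (K + 1) * (indicator {1..} u * exp (- s * u)))"
    proof (rule integral_abs_bound[THEN order_trans], rule integral_mono)
      show "integrable lborel (\<lambda>u. \<bar>?d u\<bar>)" using intd by (rule integrable_abs)
      show "integrable lborel (\<lambda>u. (K + 1) * (indicator {1..} u * exp (- s * u)))"
        using i1 by (intro integrable_mult_right) (auto simp: has_bochner_integral_iff)
      fix u :: real
      consider "u < 0" | "0 \<le> u" "u < 1" | "u \<ge> 1" by linarith
      then show "\<bar>?d u\<bar> \<le> (K + 1) * (indicator {1..} u * exp (- s * u))"
      proof cases
        case 3
        have "\<bar>dickman u - 1\<bar> \<le> K + 1" using K(2)[of u] 3 by simp
        then have "\<bar>dickman u - 1\<bar> * exp (- s * u) \<le> (K + 1) * exp (- s * u)"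
          by (intro mult_right_mono) auto
        moreover have "\<bar>?d u\<bar> = \<bar>dickman u - 1\<bar> * exp (- s * u)"
        proof -
          have "?d u = (dickman u - 1) * exp (- s * u)" using 3 by (simp add: left_diff_distrib)
          then show ?thesis by (simp only: abs_mult abs_exp_cancel)
        qed
        ultimately show ?thesis using 3 by simp
      qed (auto simp: dickman_neg dickman_unit)
    qed
    also have "\<dots> = (K + 1) * (exp (- s) / s)"
      using i1 by (simp add: has_bochner_integral_iff)
    finally have "s * \<bar>dickman_laplace s - 1 / s\<bar> \<le> s * ((K + 1) * (exp (- s) / s))"
      using s by (intro mult_left_mono) auto
    moreover have "s * \<bar>dickman_laplace s - 1 / s\<bar> = \<bar>s * dickman_laplace s - 1\<bar>"
    proof -
      have "s * dickman_laplace s - 1 = s * (dickman_laplace s - 1 / s)" using s by (simp add: field_simps)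
      then show ?thesis using s by (simp only: abs_mult)
    qed
    ultimately show ?thesis using s by simp
  qed
  show ?thesis
  proof (rule LIM_zero_cancel, rule Lim_null_comparison)
    show "\<forall>\<^sub>F s in at_top. norm (s * dickman_laplace s - 1) \<le> (K + 1) * exp (- s)"
      using le by (intro eventually_at_top_linorderI[of 1]) auto
    have "((\<lambda>s :: real. exp (- s)) \<longlongrightarrow> 0) at_top"
      by (rule filterlim_compose[OF exp_at_bot filterlim_uminus_at_bot_at_top])
    then show "((\<lambda>s. (K + 1) * exp (- s)) \<longlongrightarrow> 0) at_top" by (rule tendsto_mult_right_zero)
  qed
qed


text \<open>The integrand of the entire exponential integral \<open>Ein\<close>, completed by its limit at \<open>0\<close>.\<close>

definition ein_integrand :: "real \<Rightarrow> real" where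
  "ein_integrand t = (if t = 0 then 1 else (1 - exp (- t)) / t)"

lemma ein_integrand_continuous: "continuous_on A ein_integrand"
proof -
  have "isCont ein_integrand t" for t
  proof (cases "t = 0")
    case True
    have "((\<lambda>x. 1 - exp (- x)) has_real_derivative 1) (at (0::real))"
      by (auto intro!: derivative_eq_intros)
    then have "((\<lambda>h. (1 - exp (- h)) / h) \<longlongrightarrow> 1) (at (0::real))"
      by (simp add: DERIV_def)
    moreover have "\<forall>\<^sub>F h in at 0. (1 - exp (- h)) / h = ein_integrand h"
      by (auto simp: eventually_at ein_integrand_def intro!: exI[of _ 1])
    ultimately have "(ein_integrand \<longlongrightarrow> 1) (at 0)" by (rule Lim_transform_eventually)
    then show ?thesis using True by (simp add: isCont_def ein_integrand_def)
  next
    case False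
    have "\<forall>\<^sub>F x in nhds t. ein_integrand x = (1 - exp (- x)) / x"
      using t1_space_nhds[OF False] by eventually_elim (simp add: ein_integrand_def)
    moreover have "isCont (\<lambda>x. (1 - exp (- x)) / x) t" using False by (intro continuous_intros) auto
    ultimately show ?thesis by (simp add: isCont_cong)
  qed
  then show ?thesis by (simp add: continuous_at_imp_continuous_on)
qed

text \<open>The integrand is a geometric sum and equals \<open>(1 - (1 - t/n)\<^sup>n)/t\<close>; it is the discrete analogue of
  \<open>(1 - e\<^sup>-\<^sup>t)/t\<close>.\<close>

lemma harm_eq_integral:
  assumes n: "n > 0"
  shows "((\<lambda>t. \<Sum>k<n. (1 - t / real n) ^ k / real n) has_integral harm n) {0..real n}"
proof -
  have "((\<lambda>t. (1 - t / real n) ^ k / real n) has_integral 1 / real (Suc k)) {0..real n}" for k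
  proof -
    have "((\<lambda>t. (1 - t / real n) ^ k / real n) has_integral
        (- ((1 - real n / real n) ^ Suc k / real (Suc k)) - - ((1 - 0 / real n) ^ Suc k / real (Suc k)))) {0..real n}"
    proof (rule fundamental_theorem_of_calculus)
      fix x assume "x \<in> {0..real n}"
      have "((\<lambda>t. - ((1 - t / real n) ^ Suc k / real (Suc k))) has_real_derivative (1 - x / real n) ^ k / real n) (at x)"
      proof -
        have "((\<lambda>t. (1 - t / real n) ^ Suc k) has_real_derivative real (Suc k) * (1 - x / real n) ^ k * (- (1 / real n))) (at x)"
          using n by (auto intro!: derivative_eq_intros simp del: power_Suc)
        from DERIV_minus[OF DERIV_cdivide[OF this, of "real (Suc k)"]] show ?thesis
          by (simp del: power_Suc of_nat_Suc)
      qed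
      then show "((\<lambda>t. - ((1 - t / real n) ^ Suc k / real (Suc k))) has_vector_derivative (1 - x / real n) ^ k / real n) (at x within {0..real n})"
        by (simp add: has_real_derivative_iff_has_vector_derivative has_vector_derivative_at_within)
    qed simp
    then show ?thesis using n by simp
  qed
  then have "((\<lambda>t. \<Sum>k<n. (1 - t / real n) ^ k / real n) has_integral (\<Sum>k<n. 1 / real (Suc k))) {0..real n}"
    by (intro has_integral_sum) auto
  moreover have "(\<Sum>k<n. 1 / real (Suc k)) = harm n"
    unfolding harm_def by (rule sum.reindex_bij_witness[of _ "\<lambda>k. k - 1" Suc]) (auto simp: field_simps)
  ultimately show ?thesis by simp
qed

text \<open>The second bound is Bernoulli's inequality for \<open>(1 - t\<^sup>2/n\<^sup>2)\<^sup>n = (1 + t/n)\<^sup>n (1 - t/n)\<^sup>n\<close>, with the first factor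
  at most \<open>e\<^sup>t\<close>.\<close>

lemma exp_minus_power_bounds:
  assumes "0 \<le> t" "t \<le> real n" "n > 0"
  shows "(1 - t / real n) ^ n \<le> exp (- t)"
    and "exp (- t) - (1 - t / real n) ^ n \<le> t\<^sup>2 * exp (- t) / real n"
proof -
  show "(1 - t / real n) ^ n \<le> exp (- t)"
    using assms by (intro exp_ge_one_minus_x_over_n_power_n) auto
  have "1 - t\<^sup>2 / real n = 1 + real n * (- (t / real n)\<^sup>2)"
    using assms by (simp add: power2_eq_square)
  also have "\<dots> \<le> (1 + - (t / real n)\<^sup>2) ^ n"
    using assms by (intro Bernoulli_inequality) (auto simp: power_le_one)
  also have "1 + - (t / real n)\<^sup>2 = (1 + t / real n) * (1 - t / real n)"
    by (simp add: power2_eq_square algebra_simps)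
  also have "\<dots> ^ n = (1 + t / real n) ^ n * (1 - t / real n) ^ n" by (rule power_mult_distrib)
  also have "\<dots> \<le> exp t * (1 - t / real n) ^ n"
    using assms by (intro mult_right_mono exp_ge_one_plus_x_over_n_power_n) auto
  finally have "exp (- t) * (1 - t\<^sup>2 / real n) \<le> exp (- t) * (exp t * (1 - t / real n) ^ n)"
    by (intro mult_left_mono) auto
  then show "exp (- t) - (1 - t / real n) ^ n \<le> t\<^sup>2 * exp (- t) / real n"
    by (simp add: exp_minus field_simps)
qed

text \<open>Euler's constant enters through its definition as the limit of \<open>H\<^sub>n - log n\<close>: by the two preceding
  lemmas, \<open>H\<^sub>n\<close> and the integral of \<open>(1 - e\<^sup>-\<^sup>t)/t\<close> over \<open>[0,n]\<close> differ by at most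
  \<open>(1/n) \<integral> t e\<^sup>-\<^sup>t \<le> 1/n\<close>.\<close>

lemma ein_minus_ln_tendsto:
  "(\<lambda>n. integral {0..real n} ein_integrand - ln (real n)) \<longlonglongrightarrow> euler_mascheroni"
proof -
  have le: "\<bar>integral {0..real n} ein_integrand - harm n\<bar> \<le> 1 / real n" if n: "n > 0" for n
  proof -
    let ?p = "\<lambda>t. \<Sum>k<n. (1 - t / real n) ^ k / real n"
    have E: "(ein_integrand has_integral integral {0..real n} ein_integrand) {0..real n}"
      by (intro integrable_integral integrable_continuous_interval ein_integrand_continuous)
    have d: "((\<lambda>t. ?p t - ein_integrand t) has_integral (harm n - integral {0..real n} ein_integrand)) {0..real n}"
      by (intro has_integral_diff harm_eq_integral n E)
    have p: "t * ?p t = 1 - (1 - t / real n) ^ n" for t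
    proof -
      have "1 - (1 - t / real n) ^ n = (1 - (1 - t / real n)) * (\<Sum>k<n. (1 - t / real n) ^ k)"
        by (rule one_diff_power_eq)
      then show ?thesis by (simp add: sum_divide_distrib[symmetric])
    qed
    have eq: "?p t - ein_integrand t = (if t = 0 then 0 else (exp (- t) - (1 - t / real n) ^ n) / t)" for t
      using p[of t] n by (auto simp: ein_integrand_def field_simps)
    have b: "((\<lambda>t. t * exp (- t) / real n) has_integral
        ((- (real n + 1) * exp (- real n)) / real n - (- (0 + 1) * exp (- 0)) / real n)) {0..real n}"
    proof (rule fundamental_theorem_of_calculus)
      fix x :: real
      have "((\<lambda>t. (- (t + 1) * exp (- t)) / real n) has_real_derivative x * exp (- x) / real n) (at x)"
        using n by (auto intro!: derivative_eq_intros simp: field_simps)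
      then show "((\<lambda>t. (- (t + 1) * exp (- t)) / real n) has_vector_derivative x * exp (- x) / real n) (at x within {0..real n})"
        by (simp add: has_real_derivative_iff_has_vector_derivative has_vector_derivative_at_within)
    qed simp
    have lo: "0 \<le> ?p t - ein_integrand t" and up: "?p t - ein_integrand t \<le> t * exp (- t) / real n"
      if "t \<in> {0..real n}" for t
      using exp_minus_power_bounds[of t n] that n unfolding eq
      by (auto simp: field_simps power2_eq_square)
    have "0 \<le> harm n - integral {0..real n} ein_integrand"
      by (rule has_integral_nonneg[OF d lo])
    moreover have "harm n - integral {0..real n} ein_integrand
       \<le> ((- (real n + 1) * exp (- real n)) / real n - (- (0 + 1) * exp (- 0)) / real n)"
      by (rule has_integral_le[OF d b up])
    moreover have "(- (real n + 1) * exp (- real n)) / real n \<le> 0"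
      by (intro divide_nonpos_nonneg mult_nonpos_nonneg) auto
    then have "((- (real n + 1) * exp (- real n)) / real n - (- (0 + 1) * exp (- 0)) / real n) \<le> 1 / real n"
      by simp
    ultimately show ?thesis by simp
  qed
  have "(\<lambda>n. integral {0..real n} ein_integrand - harm n) \<longlonglongrightarrow> 0"
    by (rule Lim_null_comparison[OF _ lim_1_over_n])
      (use le in \<open>auto simp: eventually_sequentially intro!: exI[of _ 1]\<close>)
  from tendsto_add[OF this euler_mascheroni_LIMSEQ] show ?thesis by simp
qed

text \<open>Let \<open>I\<close> be the antiderivative of \<open>(1 - e\<^sup>-\<^sup>s)/s\<close> vanishing at \<open>0\<close>. The differential equation makes
  \<open>F(s) exp(I(s))\<close> constant; its value at \<open>0\<close> is the integral sought, and along the integers it equals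
  \<open>n F(n) exp(I(n) - log n)\<close>, which tends to \<open>e\<^sup>\<gamma>\<close>.\<close>

lemma dickman_integral: "has_bochner_integral lborel dickman (exp euler_mascheroni)"
proof -
  define I where "I s = integral {0..s} ein_integrand" for s
  have const: "dickman_laplace (real n) * exp (I (real n)) = dickman_laplace 0" if n: "n > 0" for n
  proof -
    have "(\<lambda>s. dickman_laplace s * exp (I s)) (real n) = (\<lambda>s. dickman_laplace s * exp (I s)) 0"
    proof (rule DERIV_isconst_end[where f = "\<lambda>s. dickman_laplace s * exp (I s)"])
      have "continuous_on {0..real n} I" unfolding I_def
        by (intro indefinite_integral_continuous_1 integrable_continuous_interval ein_integrand_continuous)
      moreover have "continuous_on {0..real n} dickman_laplace"
        by (rule continuous_at_imp_continuous_on) (use DERIV_isCont[OF dickman_laplace_deriv] in auto)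
      ultimately show "continuous_on {0..real n} (\<lambda>s. dickman_laplace s * exp (I s))"
        by (intro continuous_intros)
      fix s assume s: "0 < s" "s < real n"
      have "(I has_real_derivative ein_integrand s) (at s within {0..real n})"
        unfolding I_def [abs_def]
        by (rule integral_has_real_derivative[OF ein_integrand_continuous]) (use s in auto)
      then have dI: "(I has_real_derivative ein_integrand s) (at s)"
        using at_within_Icc_at[of 0 s "real n"] s by simp
      have dL: "(dickman_laplace has_real_derivative - ((1 - exp (- s)) / s * dickman_laplace s)) (at s)"
        using dickman_laplace_deriv[of s] dickman_laplace_deriv_eq[of s] s by simp
      show "((\<lambda>s. dickman_laplace s * exp (I s)) has_real_derivative 0) (at s)"
        using s by (auto intro!: derivative_eq_intros dI dL simp: ein_integrand_def)
    qed (use n in auto)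
    then show ?thesis by (simp add: I_def)
  qed
  have "(\<lambda>n. (real n * dickman_laplace (real n)) * exp (I (real n) - ln (real n))) \<longlonglongrightarrow> 1 * exp euler_mascheroni"
    unfolding I_def
    by (intro tendsto_intros ein_minus_ln_tendsto
        filterlim_compose[OF dickman_laplace_at_top filterlim_real_sequentially])
  moreover have "\<forall>\<^sub>F n in sequentially. (real n * dickman_laplace (real n)) * exp (I (real n) - ln (real n)) = dickman_laplace 0"
    using eventually_gt_at_top[of 0]
  proof eventually_elim
    case (elim n)
    then show ?case using const[of n] by (simp add: exp_diff)
  qed
  ultimately have "(\<lambda>_ :: nat. dickman_laplace 0) \<longlonglongrightarrow> 1 * exp euler_mascheroni"
    by (rule Lim_transform_eventually)
  then have "dickman_laplace 0 = exp euler_mascheroni"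
    by (simp add: LIMSEQ_const_iff)
  then show ?thesis
    using dickman_exp_integrable[of 0] by (simp add: dickman_laplace_def has_bochner_integral_iff)
qed

section \<open>The limit of Buchstab's function\<close>

text \<open>For \<open>u > 2\<close> the derivative is \<open>\<omega>'(u) = (\<omega>(u-1) - \<omega>(u))/u\<close>, and for \<open>u \<ge> 3\<close> the numerator is, by the
  mean value theorem, a value of \<open>-\<omega>'\<close> on \<open>[u-1, u]\<close>. So \<open>\<omega>'\<close> decays faster than any exponential, and integration gives
  the same for the oscillation of \<open>\<omega>\<close>.\<close>

lemma buchstab_diff_decay:
  assumes B: "B > 0"
  obtains K where "K \<ge> 0" "\<And>u w. 2 \<le> u \<Longrightarrow> u \<le> w \<Longrightarrow> \<bar>buchstab w - buchstab u\<bar> \<le> K * exp (- B * u)"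
proof -
  define h where "h u = (buchstab (u - 1) - buchstab u) / u" for u
  have d: "(buchstab has_real_derivative h u) (at u)" if u: "u > 2" for u
  proof -
    have "((\<lambda>t. t * buchstab t / t) has_real_derivative
        (buchstab (u - 1) * u - u * buchstab u * 1) / (u * u)) (at u)"
      by (rule DERIV_divide[OF buchstab_deriv DERIV_ident]) (use u in auto)
    also have "(buchstab (u - 1) * u - u * buchstab u * 1) / (u * u) = h u"
      using u by (simp add: h_def field_simps)
    finally show ?thesis
      by (rule has_field_derivative_transform_within_open[of _ _ _ "{2<..}"]) (use u in auto)
  qed
  have "continuous_on {2..} h"
    unfolding h_def
    by (intro continuous_intros continuous_on_subset[OF buchstab_continuous]
        continuous_on_compose2[OF buchstab_continuous]) auto
  moreover have "u * \<bar>h u\<bar> \<le> M" if u: "u \<ge> 2 + 1" and M: "\<And>t. u - 1 \<le> t \<Longrightarrow> t \<le> u \<Longrightarrow> \<bar>h t\<bar> \<le> M" for u M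
  proof -
    obtain t where t: "u - 1 < t" "t < u" "buchstab u - buchstab (u - 1) = (u - (u - 1)) * h t"
    proof -
      have "continuous_on {u - 1..u} buchstab"
        by (rule continuous_on_subset[OF buchstab_continuous]) (use u in auto)
      moreover have "\<And>x. u - 1 < x \<Longrightarrow> x < u \<Longrightarrow> (buchstab has_derivative (*) (h x)) (at x)"
        using d u by (simp add: has_field_derivative_def)
      ultimately show ?thesis using that mvt[of "u - 1" u buchstab "\<lambda>x. (*) (h x)"] by (auto simp: mult.commute)
    qed
    have "u * \<bar>h u\<bar> = \<bar>buchstab u - buchstab (u - 1)\<bar>"
      using u by (simp add: h_def abs_divide)
    also have "\<dots> \<le> M" using M[of t] t by simp
    finally show ?thesis .
  qed
  ultimately obtain K where K: "K \<ge> 0" "\<And>u. u \<ge> 2 \<Longrightarrow> \<bar>h u\<bar> \<le> K * exp (- B * u)"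
    using delay_decay[of 2 h B] B by auto
  have "\<bar>buchstab w - buchstab u\<bar> \<le> K / B * exp (- B * u)" if u: "2 \<le> u" "u \<le> w" for u w
  proof -
    \<comment> \<open>integrating \<open>\<bar>\<omega>'(t)\<bar> \<le> K e\<^sup>-\<^sup>B\<^sup>t\<close>: adding or subtracting the antiderivative makes \<open>\<omega>\<close> monotone\<close>
    have dE: "((\<lambda>t. K / B * exp (- B * t)) has_real_derivative - (K * exp (- B * t))) (at t)" for t
      using B by (auto intro!: derivative_eq_intros)
    have c: "continuous_on {u..w} buchstab"
      by (rule continuous_on_subset[OF buchstab_continuous]) (use u in auto)
    have "buchstab w + K / B * exp (- B * w) \<le> buchstab u + K / B * exp (- B * u)"
    proof (rule DERIV_nonpos_imp_decreasing_open[OF u(2)])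
      fix x assume x: "u < x" "x < w"
      have "((\<lambda>t. buchstab t + K / B * exp (- B * t)) has_real_derivative h x + - (K * exp (- B * x))) (at x)"
        by (intro DERIV_add d dE) (use x u in auto)
      moreover have "h x + - (K * exp (- B * x)) \<le> 0" using K(2)[of x] x u by auto
      ultimately show "\<exists>y. ((\<lambda>t. buchstab t + K / B * exp (- B * t)) has_real_derivative y) (at x) \<and> y \<le> 0" by blast
    qed (intro continuous_intros c)
    moreover have "buchstab u - K / B * exp (- B * u) \<le> buchstab w - K / B * exp (- B * w)"
    proof (rule DERIV_nonneg_imp_increasing_open[OF u(2)])
      fix x assume x: "u < x" "x < w"
      have "((\<lambda>t. buchstab t - K / B * exp (- B * t)) has_real_derivative h x - - (K * exp (- B * x))) (at x)"
        by (intro DERIV_diff d dE) (use x u in auto)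
      moreover have "h x - - (K * exp (- B * x)) \<ge> 0" using K(2)[of x] x u by auto
      ultimately show "\<exists>y. ((\<lambda>t. buchstab t - K / B * exp (- B * t)) has_real_derivative y) (at x) \<and> 0 \<le> y" by blast
    qed (intro continuous_intros c)
    moreover have "0 \<le> K / B * exp (- B * w)" using K B by simp
    ultimately show ?thesis by linarith
  qed
  then show ?thesis using that[of "K / B"] K(1) B by auto
qed

lemma buchstab_bounded: obtains M where "M \<ge> 0" "\<And>t. \<bar>buchstab t\<bar> \<le> M"
proof -
  obtain K where K: "K \<ge> 0" "\<And>u w. 2 \<le> u \<Longrightarrow> u \<le> w \<Longrightarrow> \<bar>buchstab w - buchstab u\<bar> \<le> K * exp (- 1 * u)"
    using buchstab_diff_decay[of 1] by auto
  obtain M where M: "M \<ge> 0" "\<And>t. t \<le> 2 \<Longrightarrow> \<bar>buchstab t\<bar> \<le> M"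
    using causal_bound[OF causal_buchstab] by metis
  have "\<bar>buchstab t\<bar> \<le> M + K" for t
  proof (cases "t \<le> 2")
    case True then show ?thesis using M(2)[of t] K(1) by simp
  next
    case False
    have "K * exp (- 1 * 2) \<le> K" using K(1) by (simp add: mult_left_le)
    then show ?thesis using K(2)[of 2 t] M(2)[of 2] False by simp
  qed
  then show ?thesis using that[of "M + K"] M K by auto
qed

text \<open>The limit exists by the Cauchy criterion. Its value \<open>l\<close> is found by letting \<open>u \<rightarrow> \<infinity>\<close> in
  \<open>\<rho> + \<omega>*\<rho> = 1\<close>, which gives \<open>l \<integral> \<rho> = 1\<close>.\<close>

lemma buchstab_tendsto: "(buchstab \<longlongrightarrow> exp (- euler_mascheroni)) at_top"
  and buchstab_decay: "B > 0 \<Longrightarrow> \<exists>K\<ge>0. \<forall>u\<ge>0. \<bar>buchstab u - exp (- euler_mascheroni)\<bar> \<le> K * exp (- B * u)"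
proof -
  obtain K1 where K1: "K1 \<ge> 0" "\<And>u w. 2 \<le> u \<Longrightarrow> u \<le> w \<Longrightarrow> \<bar>buchstab w - buchstab u\<bar> \<le> K1 * exp (- 1 * u)"
    using buchstab_diff_decay[of 1] by auto
  have lim0: "((\<lambda>u. K * exp (- 1 * u)) \<longlongrightarrow> 0) at_top" for K :: real
  proof -
    have "((\<lambda>s :: real. exp (- s)) \<longlongrightarrow> 0) at_top"
      by (rule filterlim_compose[OF exp_at_bot filterlim_uminus_at_bot_at_top])
    then show ?thesis by (intro tendsto_mult_right_zero) simp
  qed
  have "Cauchy (\<lambda>n. buchstab (real n))"
  proof (rule metric_CauchyI)
    fix e :: real assume e: "e > 0"
    have "\<forall>\<^sub>F u in at_top. K1 * exp (- 1 * u) < e / 2"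
      by (rule order_tendstoD[OF lim0]) (use e in auto)
    then obtain N where N: "\<And>u. u \<ge> N \<Longrightarrow> K1 * exp (- 1 * u) < e / 2"
      by (auto simp: eventually_at_top_linorder)
    define m where "m = max 2 (nat \<lceil>N\<rceil>)"
    have m: "real m \<ge> 2" "real m \<ge> N" unfolding m_def by linarith+
    have "dist (buchstab (real i)) (buchstab (real m)) < e / 2" if "i \<ge> m" for i
      using K1(2)[of "real m" "real i"] N[of "real m"] m that by (simp add: dist_real_def)
    then have "dist (buchstab (real i)) (buchstab (real j)) < e" if "i \<ge> m" "j \<ge> m" for i j
      using dist_triangle_half_l[of "buchstab (real i)" "buchstab (real m)" e "buchstab (real j)"] that by blast
    then show "\<exists>M. \<forall>i\<ge>M. \<forall>j\<ge>M. dist (buchstab (real i)) (buchstab (real j)) < e" by blast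
  qed
  then obtain l where l: "(\<lambda>n. buchstab (real n)) \<longlonglongrightarrow> l"
    using Cauchy_convergent convergent_def by blast
  have dec: "\<bar>l - buchstab u\<bar> \<le> K * exp (- B * u)"
    if K: "\<And>u w. 2 \<le> u \<Longrightarrow> u \<le> w \<Longrightarrow> \<bar>buchstab w - buchstab u\<bar> \<le> K * exp (- B * u)" and u: "u \<ge> 2" for K B u
  proof (rule tendsto_upperbound)
    show "(\<lambda>n. \<bar>buchstab (real n) - buchstab u\<bar>) \<longlonglongrightarrow> \<bar>l - buchstab u\<bar>"
      by (intro tendsto_intros l)
    show "\<forall>\<^sub>F n in sequentially. \<bar>buchstab (real n) - buchstab u\<bar> \<le> K * exp (- B * u)"
      using eventually_ge_at_top[of "nat \<lceil>u\<rceil>"] by eventually_elim (use K u in \<open>auto simp: nat_le_iff ceiling_le_iff\<close>)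
  qed simp
  have tl: "(buchstab \<longlongrightarrow> l) at_top"
  proof (rule LIM_zero_cancel, rule Lim_null_comparison[OF _ lim0[of K1]])
    show "\<forall>\<^sub>F u in at_top. norm (buchstab u - l) \<le> K1 * exp (- 1 * u)"
      using eventually_ge_at_top[of 2]
      by eventually_elim (use dec[OF K1(2)] in \<open>simp add: abs_minus_commute\<close>)
  qed
  obtain M where M: "M \<ge> 0" "\<And>t. \<bar>buchstab t\<bar> \<le> M" using buchstab_bounded by metis
  have le: "l = exp (- euler_mascheroni)"
  proof -
    have "(conv buchstab dickman \<longlongrightarrow> l * exp euler_mascheroni) at_top"
      using conv_tendsto[OF _ causal_measurable[OF causal_buchstab] M(2) tl, of dickman] dickman_integral
      by (auto simp: has_bochner_integral_iff)
    moreover obtain K where K: "K \<ge> 0" "\<And>u. u \<ge> 0 \<Longrightarrow> \<bar>dickman u\<bar> \<le> K * exp (- 1 * u)"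
      using dickman_decay[of 1] by auto
    have "(dickman \<longlongrightarrow> 0) at_top"
      by (rule Lim_null_comparison[OF _ lim0[of K]])
        (use K(2) in \<open>auto intro!: eventually_at_top_linorderI[of 0]\<close>)
    ultimately have "((\<lambda>u. dickman u + conv buchstab dickman u) \<longlongrightarrow> 0 + l * exp euler_mascheroni) at_top"
      by (intro tendsto_add)
    moreover have "((\<lambda>u. dickman u + conv buchstab dickman u) \<longlongrightarrow> 1) at_top"
      unfolding dickman_buchstab
      by (rule tendsto_eventually) (auto intro: eventually_at_top_linorderI[of 0])
    ultimately have "0 + l * exp euler_mascheroni = 1"
      using tendsto_unique trivial_limit_at_top_linorder by blast
    then show ?thesis by (simp add: exp_minus field_simps)
  qed
  show "(buchstab \<longlongrightarrow> exp (- euler_mascheroni)) at_top" using tl le by simp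
  assume B: "B > 0"
  obtain K where K: "K \<ge> 0" "\<And>u w. 2 \<le> u \<Longrightarrow> u \<le> w \<Longrightarrow> \<bar>buchstab w - buchstab u\<bar> \<le> K * exp (- B * u)"
    using buchstab_diff_decay[OF B] by auto
  have "\<bar>buchstab u - l\<bar> \<le> (K + (M + \<bar>l\<bar>) * exp (2 * B)) * exp (- B * u)" if "u \<ge> 0" for u
  proof (cases "u \<ge> 2")
    case True
    have "\<bar>buchstab u - l\<bar> \<le> K * exp (- B * u)" using dec[OF K(2) True] by (simp add: abs_minus_commute)
    also have "\<dots> \<le> (K + (M + \<bar>l\<bar>) * exp (2 * B)) * exp (- B * u)"
      using M(1) by (intro mult_right_mono) auto
    finally show ?thesis .
  next
    case False
    have "\<bar>buchstab u - l\<bar> \<le> (M + \<bar>l\<bar>) * 1" using M(2)[of u] by simp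
    also have "\<dots> \<le> (M + \<bar>l\<bar>) * (exp (2 * B) * exp (- B * u))"
      using False B M(1) by (intro mult_left_mono) (auto simp: exp_add[symmetric])
    also have "\<dots> \<le> (K + (M + \<bar>l\<bar>) * exp (2 * B)) * exp (- B * u)"
      using K(1) by (simp add: distrib_right)
    finally show ?thesis .
  qed
  then show "\<exists>K\<ge>0. \<forall>u\<ge>0. \<bar>buchstab u - exp (- euler_mascheroni)\<bar> \<le> K * exp (- B * u)"
    unfolding le using K(1) M(1) by (intro exI[of _ "K + (M + \<bar>l\<bar>) * exp (2 * B)"]) (auto simp: le)
qed


section \<open>Smooth and rough numbers\<close>

lemma smooth_pos: "n \<in> smooth y \<Longrightarrow> n > 0"
  by (simp add: smooth_def)

lemma smooth_rough_coprime:
  assumes "n \<in> smooth y" "r \<in> rough y"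
  shows "coprime n r"
proof (rule ccontr)
  assume "\<not> coprime n r"
  then have "gcd n r \<noteq> 1" by (simp add: coprime_iff_gcd_eq_1)
  then obtain p where p: "prime p" "p dvd gcd n r" using prime_factor_nat by blast
  then have "real p \<le> y" "real p > y" using assms by (auto simp: smooth_def rough_def)
  then show False by simp
qed

lemma smooth_rough_factorization:
  "m > 0 \<Longrightarrow> \<exists>n\<in>smooth y. \<exists>r\<in>rough y. m = n * r"
proof (induction m rule: less_induct)
  case (less m)
  show ?case
  proof (cases "m = 1")
    case True
    then show ?thesis by (intro bexI[of _ 1]) (auto simp: smooth_def rough_def)
  next
    case False
    then obtain p where p: "prime p" "p dvd m" using prime_factor_nat by blast
    then obtain k where k: "m = p * k" by (elim dvdE)
    have "k > 0" "k < m" using k less.prems prime_gt_1_nat[OF p(1)] by auto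
    then obtain n r where nr: "n \<in> smooth y" "r \<in> rough y" "k = n * r" using less.IH by blast
    show ?thesis
    proof (cases "real p \<le> y")
      case True
      have "p * n \<in> smooth y"
        using nr(1) p(1) True prime_gt_0_nat[OF p(1)]
        by (auto simp: smooth_def prime_dvd_mult_iff primes_dvd_imp_eq dest: primes_dvd_imp_eq)
      then show ?thesis using nr k by (intro bexI[of _ "p * n"] bexI[of _ r]) auto
    next
      case False
      have "p * r \<in> rough y"
        using nr(2) p(1) False prime_gt_0_nat[OF p(1)]
        by (auto simp: rough_def prime_dvd_mult_iff dest: primes_dvd_imp_eq)
      then show ?thesis using nr k by (intro bexI[of _ n] bexI[of _ "p * r"]) auto
    qed
  qed
qed

lemma smooth_rough_unique:
  assumes "n \<in> smooth y" "r \<in> rough y" "n' \<in> smooth y" "r' \<in> rough y" "n * r = n' * r'"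
  shows "n = n' \<and> r = r'"
proof -
  have "n dvd n' * r'" using assms(5) by (metis dvd_triv_left)
  then have 1: "n dvd n'" using smooth_rough_coprime[OF assms(1,4)] coprime_dvd_mult_left_iff by blast
  have "n' dvd n * r" using assms(5) by (metis dvd_triv_left)
  then have 2: "n' dvd n" using smooth_rough_coprime[OF assms(3,2)] coprime_dvd_mult_left_iff by blast
  have "n = n'" using 1 2 by (rule dvd_antisym)
  with assms(5) smooth_pos[OF assms(1)] show ?thesis by simp
qed

definition smooth_upto :: "real \<Rightarrow> real \<Rightarrow> nat set" where
  "smooth_upto x y = {n \<in> smooth y. real n \<le> x}"

lemma finite_nat_le_real: "finite {n :: nat. P n \<and> real n \<le> x}"
  by (rule finite_subset[of _ "{..nat \<lfloor>x\<rfloor>}"]) (auto simp: le_nat_floor)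

lemma finite_smooth_upto: "finite (smooth_upto x y)"
  unfolding smooth_upto_def by (rule finite_nat_le_real)

text \<open>Each positive \<open>m \<le> x\<close> is counted once, namely at its smooth part \<open>n\<close>.\<close>

lemma sum_Phi_smooth:
  assumes x: "x \<ge> 0"
  shows "(\<Sum>n\<in>smooth_upto x y. real (Phi (x / real n) y)) = of_int \<lfloor>x\<rfloor>"
proof -
  let ?B = "\<lambda>n. {r \<in> rough y. real r \<le> x / real n}"
  have "(\<Sum>n\<in>smooth_upto x y. Phi (x / real n) y) = card (SIGMA n:smooth_upto x y. ?B n)"
    unfolding Phi_def by (subst card_SigmaI) (auto intro: finite_smooth_upto finite_nat_le_real)
  also have "\<dots> = card {m :: nat. m > 0 \<and> real m \<le> x}"
  proof (rule bij_betw_same_card)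
    show "bij_betw (\<lambda>(n, r). n * r) (SIGMA n:smooth_upto x y. ?B n) {m. m > 0 \<and> real m \<le> x}"
      unfolding bij_betw_def
    proof
      show "inj_on (\<lambda>(n, r). n * r) (SIGMA n:smooth_upto x y. ?B n)"
        using smooth_rough_unique by (fastforce simp: inj_on_def smooth_upto_def)
      show "(\<lambda>(n, r). n * r) ` (SIGMA n:smooth_upto x y. ?B n) = {m. m > 0 \<and> real m \<le> x}"
      proof (intro equalityI subsetI)
        fix m assume "m \<in> (\<lambda>(n, r). n * r) ` (SIGMA n:smooth_upto x y. ?B n)"
        then obtain n r where "m = n * r" "n \<in> smooth y" "r \<in> rough y" "real r \<le> x / real n"
          by (auto simp: smooth_upto_def)
        then show "m \<in> {m. m > 0 \<and> real m \<le> x}"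
          by (auto simp: smooth_def rough_def field_simps)
      next
        fix m assume m: "m \<in> {m :: nat. m > 0 \<and> real m \<le> x}"
        then obtain n r where nr: "n \<in> smooth y" "r \<in> rough y" "m = n * r"
          using smooth_rough_factorization[of m y] by auto
        then have pos: "n > 0" "r > 0" by (auto simp: smooth_def rough_def)
        have "real n * real r \<le> x" using m nr by simp
        moreover have "real n \<le> real n * real r" using pos by simp
        ultimately have "real n \<le> x" by linarith
        moreover have "real r \<le> x / real n" using \<open>real n * real r \<le> x\<close> pos by (simp add: field_simps)
        ultimately have "(n, r) \<in> (SIGMA n:smooth_upto x y. ?B n)" using nr by (auto simp: smooth_upto_def)
        then show "m \<in> (\<lambda>(n, r). n * r) ` (SIGMA n:smooth_upto x y. ?B n)"
          using nr(3) by (force intro: rev_image_eqI)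
      qed
    qed
  qed
  also have "{m :: nat. m > 0 \<and> real m \<le> x} = {1..nat \<lfloor>x\<rfloor>}"
    using x by (auto simp: le_nat_floor le_nat_iff le_floor_iff)
  finally have "(\<Sum>n\<in>smooth_upto x y. Phi (x / real n) y) = nat \<lfloor>x\<rfloor>" by simp
  then have "real (\<Sum>n\<in>smooth_upto x y. Phi (x / real n) y) = real (nat \<lfloor>x\<rfloor>)" by simp
  then show ?thesis using x by simp
qed

text \<open>Induction on the set of primes: a number composed of primes in \<open>P \<union> {p}\<close> is uniquely \<open>p\<^sup>k m\<close> with \<open>m\<close>
  composed of primes in \<open>P\<close>, and the sum over \<open>k\<close> is geometric.\<close>

lemma euler_product:
  assumes s: "s > 0" and P: "finite P" "\<And>p. p \<in> P \<Longrightarrow> prime p"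
  shows "((\<lambda>n. real n powr (- s)) has_sum (\<Prod>p\<in>P. 1 / (1 - real p powr (- s))))
      {n. n > 0 \<and> (\<forall>p. prime p \<longrightarrow> p dvd n \<longrightarrow> p \<in> P)}"
  using P
proof (induction P rule: finite_induct)
  case empty
  have "{n :: nat. n > 0 \<and> (\<forall>p. prime p \<longrightarrow> p dvd n \<longrightarrow> p \<in> {})} = {1}"
    using prime_factor_nat by auto
  then show ?case using has_sum_finite[of "{1::nat}" "\<lambda>n. real n powr (- s)"] by simp
next
  case (insert p P)
  let ?S = "\<lambda>P. {n :: nat. n > 0 \<and> (\<forall>p. prime p \<longrightarrow> p dvd n \<longrightarrow> p \<in> P)}"
  let ?f = "\<lambda>n. real n powr (- s)" and ?q = "real p powr (- s)"
  define E where "E = (\<Prod>p\<in>P. 1 / (1 - real p powr (- s)))"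
  have p: "prime p" using insert.prems by simp
  have q: "?q > 0" "?q < 1"
    using prime_gt_1_nat[OF p] s by (auto intro!: powr_less_one simp: powr_minus_divide)
  have IH: "(?f has_sum E) (?S P)" unfolding E_def using insert by simp
  have inner: "((\<lambda>m. ?f (p ^ k * m)) has_sum (?q ^ k * E)) (?S P)" for k
  proof -
    have "?f (p ^ k * m) = ?q ^ k * ?f m" for m
      by (simp add: powr_mult powr_realpow[symmetric] powr_powr prime_gt_0_nat[OF p] mult.commute powr_power)
    then show ?thesis using has_sum_cmult_right[OF IH, of "?q ^ k"] by simp
  qed
  have "(\<lambda>k. ?q ^ k) sums (1 / (1 - ?q))" using q by (intro geometric_sums) auto
  then have "((\<lambda>k. ?q ^ k) has_sum (1 / (1 - ?q))) UNIV"
    by (rule sums_nonneg_imp_has_sum) auto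
  then have outer: "((\<lambda>k. ?q ^ k * E) has_sum (1 / (1 - ?q) * E)) UNIV"
    by (rule has_sum_cmult_left)
  have "((\<lambda>(k, m). ?f (p ^ k * m)) has_sum (1 / (1 - ?q) * E)) (UNIV \<times> ?S P)"
  proof (rule has_sum_SigmaI)
    show "(\<lambda>(k, m). ?f (p ^ k * m)) summable_on UNIV \<times> ?S P"
      by (rule summable_on_SigmaI[OF _ _ _]) (use inner outer in \<open>auto intro: has_sum_imp_summable\<close>)
  qed (use inner outer in auto)
  moreover have "bij_betw (\<lambda>(k, m). p ^ k * m) (UNIV \<times> ?S P) (?S (insert p P))"
    unfolding bij_betw_def
  proof
    have nd: "\<not> p dvd m" if "m \<in> ?S P" for m using that insert.hyps p by auto
    have inj: "k = k' \<and> m = m'" if "p ^ k * m = p ^ k' * m'" "m \<in> ?S P" "m' \<in> ?S P" for k k' m m'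
    proof -
      have mult: "multiplicity p (p ^ k * m) = k" if "m \<in> ?S P" for k m
        using nd[OF that] prime_gt_0_nat[OF p] by (intro multiplicity_decomposeI[OF refl]) auto
      have "k = k'" using mult[OF that(2), of k] mult[OF that(3), of k'] that(1) by simp
      with that show ?thesis using prime_gt_0_nat[OF p] by simp
    qed
    show "inj_on (\<lambda>(k, m). p ^ k * m) (UNIV \<times> ?S P)"
    proof (rule inj_onI)
      fix a b assume "a \<in> UNIV \<times> ?S P" "b \<in> UNIV \<times> ?S P"
        "(case a of (k, m) \<Rightarrow> p ^ k * m) = (case b of (k, m) \<Rightarrow> p ^ k * m)"
      then have "fst a = fst b \<and> snd a = snd b"
        by (intro inj) (simp_all only: case_prod_beta mem_Times_iff)
      then show "a = b" by (simp add: prod_eq_iff)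
    qed
    show "(\<lambda>(k, m). p ^ k * m) ` (UNIV \<times> ?S P) = ?S (insert p P)"
    proof (intro equalityI subsetI)
      fix n assume "n \<in> (\<lambda>(k, m). p ^ k * m) ` (UNIV \<times> ?S P)"
      then obtain k m where km: "n = p ^ k * m" "m \<in> ?S P" by auto
      have "q \<in> insert p P" if "prime q" "q dvd n" for q
      proof (cases "q dvd m")
        case True
        then show ?thesis using km(2) that(1) by simp
      next
        case False
        then have "q dvd p" using km(1) that by (auto simp: prime_dvd_mult_iff dest: prime_dvd_power)
        then show ?thesis using primes_dvd_imp_eq[OF that(1) p] by simp
      qed
      then show "n \<in> ?S (insert p P)" using km prime_gt_0_nat[OF p] by simp
    next
      fix n assume n: "n \<in> ?S (insert p P)"
      obtain m where m: "n = p ^ multiplicity p n * m" "\<not> p dvd m"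
      proof -
        have "n \<noteq> 0" "\<not> is_unit p" using n p not_prime_unit by auto
        then show ?thesis using multiplicity_decompose'[of n p] that by blast
      qed
      have "m dvd n" using m(1) by (metis dvd_triv_right)
      then have "m > 0" "\<And>q. q dvd m \<Longrightarrow> q dvd n" using n by (auto intro: dvd_trans dvd_pos_nat)
      then have "m \<in> ?S P" using n m(2) by auto
      then show "n \<in> (\<lambda>(k, m). p ^ k * m) ` (UNIV \<times> ?S P)"
        using m(1) by (intro image_eqI[of _ _ "(multiplicity p n, m)"]) auto
    qed
  qed
  ultimately have "(?f has_sum (1 / (1 - ?q) * E)) (?S (insert p P))"
    using has_sum_reindex_bij_betw[of "\<lambda>(k, m). p ^ k * m" "UNIV \<times> ?S P" "?S (insert p P)" ?f]
    by (simp only: case_prod_unfold)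
  then show ?case using insert.hyps by (simp add: E_def)
qed

lemma smooth_has_sum:
  assumes s: "s > 0"
  shows "((\<lambda>n. real n powr (- s)) has_sum (\<Prod>p | prime p \<and> real p \<le> y. 1 / (1 - real p powr (- s)))) (smooth y)"
proof -
  have "smooth y = {n. n > 0 \<and> (\<forall>p. prime p \<longrightarrow> p dvd n \<longrightarrow> p \<in> {p. prime p \<and> real p \<le> y})}"
    by (auto simp: smooth_def)
  then show ?thesis using euler_product[OF s finite_nat_le_real[of prime y]] by simp
qed

lemma prime_prod_pos: "prime_prod y > 0"
  unfolding prime_prod_def by (intro prod_pos) (auto dest: prime_gt_1_nat)

lemma smooth_reciprocal_has_sum: "((\<lambda>n. 1 / real n) has_sum (1 / prime_prod y)) (smooth y)"
proof -
  have "((\<lambda>n. real n powr (- 1)) has_sum (\<Prod>p | prime p \<and> real p \<le> y. 1 / (1 - real p powr (- 1)))) (smooth y)"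
    by (rule smooth_has_sum) simp
  then show ?thesis by (simp add: powr_minus_divide prime_prod_def prod_dividef)
qed

text \<open>Rankin's method with exponent \<open>1/2\<close>: each \<open>n \<le> x\<close> is weighted by \<open>(x/n)\<^bsup>1/2\<^esup> \<ge> 1\<close>. The constant depends on
  \<open>y\<close>, which is harmless, since the bound is used only to let \<open>x \<rightarrow> \<infinity>\<close> with \<open>y\<close> fixed.\<close>

lemma Psi_rankin: 
  obtains C where "C \<ge> 0" "\<And>x. x > 0 \<Longrightarrow> real (Psi x y) \<le> C * x powr (1/2)"
proof -
  let ?C = "\<Prod>p | prime p \<and> real p \<le> y. 1 / (1 - real p powr (- (1/2)))"
  have C: "((\<lambda>n. real n powr (- (1/2))) has_sum ?C) (smooth y)"
    by (rule smooth_has_sum) simp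
  have "real (Psi x y) \<le> ?C * x powr (1/2)" if x: "x > 0" for x
  proof -
    have "real (Psi x y) = (\<Sum>n\<in>smooth_upto x y. 1)" by (simp add: Psi_def smooth_upto_def)
    also have "\<dots> \<le> (\<Sum>n\<in>smooth_upto x y. real n powr (- (1/2)) * x powr (1/2))"
    proof (rule sum_mono)
      fix n assume "n \<in> smooth_upto x y"
      then have n: "n > 0" "real n \<le> x" by (auto simp: smooth_upto_def smooth_def)
      have "1 = real n powr (- (1/2)) * real n powr (1/2)" using n by (simp add: powr_add[symmetric])
      also have "\<dots> \<le> real n powr (- (1/2)) * x powr (1/2)"
        using n by (intro mult_left_mono powr_mono2) auto
      finally show "1 \<le> real n powr (- (1/2)) * x powr (1/2)" .
    qed
    also have "\<dots> = (\<Sum>n\<in>smooth_upto x y. real n powr (- (1/2))) * x powr (1/2)"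
      by (simp add: sum_distrib_right)
    also have "\<dots> \<le> ?C * x powr (1/2)"
      by (intro mult_right_mono finite_sum_le_has_sum[OF C finite_smooth_upto]) (auto simp: smooth_upto_def)
    finally show ?thesis .
  qed
  moreover have "?C \<ge> 0" using C by (rule has_sum_nonneg) auto
  ultimately show ?thesis using that by blast
qed

lemma mu_neg: "u < 0 \<Longrightarrow> mu y u = 0"
  by (simp add: mu_def)

text \<open>The terms of \<open>Q(x/n,y)\<close> with an unbounded range of \<open>n\<close> are multiples of \<open>1/n\<close> and are summed by the
  Euler product. All others vanish for \<open>n > x\<close>, where \<open>x/n < 1\<close>.\<close>

lemma R_eq:
  assumes x: "x \<ge> 1" and y: "y \<ge> 2"
  shows "R x y = real (Psi x y) - of_int \<lfloor>x\<rfloor>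
      + x * (1 - exp (- euler_mascheroni) / (prime_prod y * ln y))
      + x * (\<Sum>n\<in>smooth_upto x y. 1 / real n * mu y (ln (x / real n) / ln y))"
proof -
  let ?c = "prime_prod y - exp (- euler_mascheroni) / ln y"
  let ?g = "\<lambda>n. if real n \<le> x then 1 + x / real n * mu y (ln (x / real n) / ln y) - real (Phi (x / real n) y) else 0"
  have Q: "Q (x / real n) y = ?g n + x * ?c * (1 / real n)" if n: "n \<in> smooth y" for n
  proof -
    have n0: "real n > 0" using smooth_pos[OF n] by simp
    have iff: "x / real n \<ge> 1 \<longleftrightarrow> real n \<le> x" using n0 by (simp add: field_simps)
    show ?thesis
    proof (cases "real n \<le> x")
      case True
      then show ?thesis using iff by (simp add: Q_def V_def Let_def algebra_simps)
    next
      case False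
      then have lt: "x / real n < 1" using iff by linarith
      have "ln (x / real n) < 0" using lt x n0 by (subst ln_less_zero_iff) auto
      then have "mu y (ln (x / real n) / ln y) = 0"
        using y by (intro mu_neg divide_neg_pos) auto
      moreover have "{m \<in> rough y. real m \<le> x / real n} = {}"
        using lt by (auto simp: rough_def) 
      then have "Phi (x / real n) y = 0" by (simp only: Phi_def card.empty)
      ultimately show ?thesis using False lt by (simp add: Q_def V_def Let_def algebra_simps)
    qed
  qed
  have "(?g has_sum (\<Sum>n\<in>smooth_upto x y. ?g n)) (smooth y)"
    by (rule has_sum_finite_neutralI[OF finite_smooth_upto]) (auto simp: smooth_upto_def)
  from has_sum_add[OF this has_sum_cmult_right[OF smooth_reciprocal_has_sum, of "x * ?c" y]]
  have "((\<lambda>n. Q (x / real n) y) has_sum ((\<Sum>n\<in>smooth_upto x y. ?g n) + x * ?c * (1 / prime_prod y))) (smooth y)"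
    by (rule has_sum_cong[THEN iffD1, rotated]) (simp add: Q)
  then have "R x y = (\<Sum>n\<in>smooth_upto x y. ?g n) + x * ?c * (1 / prime_prod y)"
    unfolding R_def by (rule infsumI)
  also have "(\<Sum>n\<in>smooth_upto x y. ?g n)
      = (\<Sum>n\<in>smooth_upto x y. (1 + x * (1 / real n * mu y (ln (x / real n) / ln y))) - real (Phi (x / real n) y))"
    by (rule sum.cong) (auto simp: smooth_upto_def)
  also have "\<dots> = real (Psi x y) + x * (\<Sum>n\<in>smooth_upto x y. 1 / real n * mu y (ln (x / real n) / ln y)) - of_int \<lfloor>x\<rfloor>"
    using sum_Phi_smooth[of x y] x
    by (simp add: sum_subtractf sum.distrib sum_distrib_left Psi_def smooth_upto_def)
  also have "x * ?c * (1 / prime_prod y) = x * (1 - exp (- euler_mascheroni) / (prime_prod y * ln y))"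
    using prime_prod_pos[of y] y by (simp add: field_simps)
  finally show ?thesis by simp
qed


section \<open>The logarithmic scale\<close>

text \<open>The function \<open>y\<^sup>-\<^sup>v\<close>, cut off at \<open>v < 0\<close>. Convolved with \<open>\<omega>\<close> it gives \<open>\<mu>\<^sub>y\<close>, and \<open>P\<close> is a sum of its
  translates; this common origin is what turns the sum of \<open>\<mu>\<^sub>y\<close> over smooth numbers into \<open>\<omega>*P\<close>.\<close>

definition exp_step :: "real \<Rightarrow> real \<Rightarrow> real" where
  "exp_step y v = step v * exp (- ln y * v)"

lemma causal_exp_step: "causal (exp_step y)"
  unfolding exp_step_def [abs_def] by (rule causal_times_exp[OF causal_step])

lemma mu_eq_conv:
  assumes y: "y > 0" shows "mu y u = conv buchstab (exp_step y) u"
  unfolding mu_def conv_eq_integral(1)[OF causal_buchstab causal_exp_step]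
  by (rule integral_cong) (use y in \<open>auto simp: exp_step_def powr_def mult.commute\<close>)

lemma conv_step_exp_step:
  assumes y: "y > 1" and t: "t \<ge> 0"
  shows "conv step (exp_step y) t = (1 - y powr (- t)) / ln y"
proof -
  have "((\<lambda>v. exp (- ln y * v)) has_integral (- exp (- ln y * t) / ln y - - exp (- ln y * 0) / ln y)) {0..t}"
    by (rule fundamental_theorem_of_calculus[OF t])
      (use y in \<open>auto intro!: derivative_eq_intros simp flip: has_real_derivative_iff_has_vector_derivative\<close>)
  then have "integral {0..t} (\<lambda>v. exp (- ln y * v)) = (1 - y powr (- t)) / ln y"
    using y by (simp add: integral_unique powr_def field_simps)
  moreover have "integral {0..t} (exp_step y) = integral {0..t} (\<lambda>v. exp (- ln y * v))"
    by (rule integral_cong) (simp add: exp_step_def)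
  ultimately show ?thesis by (simp add: conv_step_eq_integral causal_exp_step)
qed

definition smooth_density :: "real \<Rightarrow> real \<Rightarrow> real" where
  "smooth_density y u = (if u \<ge> 0 then real (Psi (y powr u) y) / y powr u else 0)"

lemma Psi_mono: "x \<le> x' \<Longrightarrow> Psi x y \<le> Psi x' y"
  unfolding Psi_def by (rule card_mono[OF finite_nat_le_real]) auto

lemma smooth_density_bound:
  assumes y: "y > 1"
  obtains C where "C \<ge> 0" "\<And>u. u \<ge> 0 \<Longrightarrow> \<bar>smooth_density y u\<bar> \<le> C * exp (- (ln y / 2) * u)"
proof -
  obtain C where C: "C \<ge> 0" "\<And>x. x > 0 \<Longrightarrow> real (Psi x y) \<le> C * x powr (1/2)"
    using Psi_rankin[of y] by metis
  have "\<bar>smooth_density y u\<bar> \<le> C * exp (- (ln y / 2) * u)" if u: "u \<ge> 0" for u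
  proof -
    have "\<bar>smooth_density y u\<bar> \<le> C * (y powr u) powr (1/2) / y powr u"
      using C(2)[of "y powr u"] y u by (simp add: smooth_density_def divide_right_mono)
    also have "\<dots> = C * ((y powr u) powr (1/2) / y powr u)" by simp
    also have "(y powr u) powr (1/2) / y powr u = exp (- (ln y / 2) * u)"
      using y by (simp add: powr_powr powr_diff[symmetric] powr_def) (simp add: exp_diff[symmetric] algebra_simps)
    finally show ?thesis .
  qed
  with C(1) that show ?thesis by blast
qed

lemma causal_smooth_density:
  assumes y: "y > 1" shows "causal (smooth_density y)"
proof -
  obtain C where C: "C \<ge> 0" "\<And>u. u \<ge> 0 \<Longrightarrow> \<bar>smooth_density y u\<bar> \<le> C * exp (- (ln y / 2) * u)"
    using smooth_density_bound[OF y] by metis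
  show ?thesis
  proof (rule causal_boundedI)
    have [measurable]: "(\<lambda>u. real (Psi (y powr u) y)) \<in> borel_measurable borel"
      by (rule borel_measurable_mono) (use y in \<open>auto simp: mono_def intro!: Psi_mono powr_mono\<close>)
    have "(\<lambda>u. step u * (real (Psi (y powr u) y) / y powr u)) \<in> borel_measurable borel"
      by measurable
    also have "(\<lambda>u. step u * (real (Psi (y powr u) y) / y powr u)) = smooth_density y"
      by (auto simp: fun_eq_iff smooth_density_def not_le)
    finally show "smooth_density y \<in> borel_measurable borel" .
    show "\<bar>smooth_density y u\<bar> \<le> C" if "u \<ge> 0" for u
    proof -
      have "C * exp (- (ln y / 2) * u) \<le> C * 1" using C(1) y that by (intro mult_left_mono) auto
      then show ?thesis using C(2)[OF that] by simp
    qed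
  qed (simp add: smooth_density_def)
qed

text \<open>The translate belonging to \<open>n\<close> starts at \<open>v = log n / log y\<close>, that is, at \<open>y\<^sup>v = n\<close>. The range of summation
  is fixed by a later point \<open>u \<ge> v\<close>, so that one finite sum represents the function on all of \<open>(-\<infinity>, u]\<close>.\<close>

lemma smooth_density_eq_sum:
  assumes y: "y > 1" and v: "v \<le> u"
  shows "smooth_density y v = (\<Sum>n\<in>smooth_upto (y powr u) y. 1 / real n * exp_step y (v - ln (real n) / ln y))"
proof -
  have t: "1 / real n * exp_step y (v - ln (real n) / ln y) = (if real n \<le> y powr v then y powr (- v) else 0)"
    if "n > 0" for n
  proof -
    have "real n \<le> y powr v \<longleftrightarrow> ln (real n) / ln y \<le> v"
    proof -
      have "real n \<le> y powr v \<longleftrightarrow> ln (real n) \<le> ln (y powr v)" using that y by (subst ln_le_cancel_iff) auto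
      also have "\<dots> \<longleftrightarrow> ln (real n) / ln y \<le> v" using y by (simp add: ln_powr field_simps)
      finally show ?thesis .
    qed
    moreover have "exp (- ln y * (v - ln (real n) / ln y)) = real n * y powr (- v)"
    proof -
      have "- ln y * (v - ln (real n) / ln y) = ln (real n) + (- v) * ln y" using y by (simp add: field_simps)
      then show ?thesis using that y by (simp only: exp_add) (simp add: powr_def)
    qed
    ultimately show ?thesis using that by (auto simp: exp_step_def not_le)
  qed
  have "(\<Sum>n\<in>smooth_upto (y powr u) y. 1 / real n * exp_step y (v - ln (real n) / ln y))
      = (\<Sum>n\<in>smooth_upto (y powr u) y. if real n \<le> y powr v then y powr (- v) else 0)"
    by (intro sum.cong t refl) (auto simp: smooth_upto_def smooth_def)
  also have "\<dots> = (\<Sum>n\<in>smooth_upto (y powr v) y. y powr (- v))"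
  proof -
    have "y powr v \<le> y powr u" using y v by simp
    then have "smooth_upto (y powr v) y = {n \<in> smooth_upto (y powr u) y. real n \<le> y powr v}"
      by (auto simp: smooth_upto_def)
    then show ?thesis using finite_smooth_upto by (simp add: sum.inter_filter[symmetric])
  qed
  also have "\<dots> = smooth_density y v"
  proof (cases "v \<ge> 0")
    case True
    then show ?thesis using y by (simp add: smooth_density_def Psi_def smooth_upto_def powr_minus_divide)
  next
    case False
    then have "y powr v < 1" using y by (simp add: powr_less_one)
    then have "smooth_upto (y powr v) y = {}" by (auto simp: smooth_upto_def smooth_def)
    then show ?thesis using False by (simp add: smooth_density_def)
  qed
  finally show ?thesis by simp
qed

lemma conv_smooth_density:
  assumes y: "y > 1" and k: "causal k" and u: "u \<ge> 0"
  shows "conv k (smooth_density y) u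
    = (\<Sum>n\<in>smooth_upto (y powr u) y. 1 / real n * conv k (exp_step y) (u - ln (real n) / ln y))"
proof -
  let ?e = "\<lambda>n v. exp_step y (v - ln (real n) / ln y)"
  have ce: "causal (?e n)" if "n \<in> smooth_upto (y powr u) y" for n
    using that y by (intro causal_shift causal_exp_step) (auto simp: smooth_upto_def smooth_def)
  have "conv k (smooth_density y) u
      = (LINT v|lborel. (\<Sum>n\<in>smooth_upto (y powr u) y. 1 / real n * (k (u - v) * ?e n v)))"
    unfolding conv_def
  proof (rule Bochner_Integration.integral_cong[OF refl])
    fix v
    show "k (u - v) * smooth_density y v = (\<Sum>n\<in>smooth_upto (y powr u) y. 1 / real n * (k (u - v) * ?e n v))"
    proof (cases "v \<le> u")
      case True
      show ?thesis unfolding smooth_density_eq_sum[OF y True] sum_distrib_left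
        by (intro sum.cong refl) simp
    qed (simp add: causal_neg[OF k])
  qed
  also have "\<dots> = (\<Sum>n\<in>smooth_upto (y powr u) y. 1 / real n * conv k (?e n) u)"
    unfolding conv_def
    by (subst Bochner_Integration.integral_sum) (auto intro!: conv_integrable k ce)
  also have "\<dots> = (\<Sum>n\<in>smooth_upto (y powr u) y. 1 / real n * conv k (exp_step y) (u - ln (real n) / ln y))"
    using conv_shift[of "exp_step y" _ k u] by (simp only: conv_commute[of k])
  finally show ?thesis .
qed

lemma exp_decay_tendsto_0:
  fixes c :: real assumes "c > 0" shows "((\<lambda>u. K * exp (- c * u)) \<longlongrightarrow> 0) at_top"
proof -
  have "LIM t at_top. - c * t :> at_bot"
    using assms by (intro filterlim_tendsto_neg_mult_at_bot[OF tendsto_const] filterlim_ident) auto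
  then have "((\<lambda>t. exp (- c * t)) \<longlongrightarrow> 0) at_top"
    by (rule filterlim_compose[OF exp_at_bot])
  then show ?thesis by (rule tendsto_mult_right_zero)
qed

lemma exp_bound_tendsto_0:
  fixes f :: "real \<Rightarrow> real"
  assumes "c > 0" "\<And>u. u \<ge> 0 \<Longrightarrow> \<bar>f u\<bar> \<le> K * exp (- c * u)"
  shows "(f \<longlongrightarrow> 0) at_top"
  by (rule Lim_null_comparison[OF _ exp_decay_tendsto_0[OF assms(1), of K]])
    (use assms(2) in \<open>auto intro!: eventually_at_top_linorderI[of 0]\<close>)

lemma smooth_density_tendsto_0:
  assumes "y > 1" shows "(smooth_density y \<longlongrightarrow> 0) at_top"
proof -
  obtain C where "C \<ge> 0" "\<And>u. u \<ge> 0 \<Longrightarrow> \<bar>smooth_density y u\<bar> \<le> C * exp (- (ln y / 2) * u)"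
    using smooth_density_bound[OF assms] by metis
  then show ?thesis using assms by (intro exp_bound_tendsto_0[of "ln y / 2" _ C]) auto
qed

text \<open>Integrating the sum of translates up to \<open>u\<close> gives \<open>(\<Sum> 1/n - P(u))/log y\<close> over smooth \<open>n \<le> y\<^sup>u\<close>. As
  \<open>P(u) \<rightarrow> 0\<close>, the Euler product gives the limit.\<close>

lemma smooth_density_integral:
  assumes y: "y > 1"
  shows "has_bochner_integral lborel (smooth_density y) (1 / (prime_prod y * ln y))"
proof -
  obtain C where C: "\<And>u. u \<ge> 0 \<Longrightarrow> \<bar>smooth_density y u\<bar> \<le> C * exp (- (ln y / 2) * u)"
    using smooth_density_bound[OF y] by metis
  have int: "integrable lborel (smooth_density y)"
    by (rule integrable_exp_bound[OF causal_smooth_density[OF y] _ C]) (use y in auto)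
  let ?F = "\<lambda>u. smooth_upto (y powr u) y"
  have eq: "conv step (smooth_density y) u = ((\<Sum>n\<in>?F u. 1 / real n) - smooth_density y u) / ln y" if u: "u \<ge> 0" for u
  proof -
    have "conv step (smooth_density y) u = (\<Sum>n\<in>?F u. (1 / real n - y powr (- u)) / ln y)"
      unfolding conv_smooth_density[OF y causal_step u]
    proof (rule sum.cong[OF refl])
      fix n assume "n \<in> ?F u"
      then have n: "n > 0" "real n \<le> y powr u" by (auto simp: smooth_upto_def smooth_def)
      have "ln (real n) \<le> ln (y powr u)" using n y by (subst ln_le_cancel_iff) auto
      then have t: "u - ln (real n) / ln y \<ge> 0" using y by (simp add: ln_powr field_simps)
      have "y powr (- (u - ln (real n) / ln y)) = real n * y powr (- u)"
      proof -
        have "y powr (- (u - ln (real n) / ln y)) = y powr (ln (real n) / ln y) * y powr (- u)"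
          by (simp add: powr_add[symmetric])
        also have "y powr (ln (real n) / ln y) = real n" using y n by (simp add: powr_def)
        finally show ?thesis .
      qed
      then show "1 / real n * conv step (exp_step y) (u - ln (real n) / ln y) = (1 / real n - y powr (- u)) / ln y"
        unfolding conv_step_exp_step[OF y t] using n y by (simp add: field_simps)
    qed
    also have "\<dots> = ((\<Sum>n\<in>?F u. 1 / real n) - real (card (?F u)) * y powr (- u)) / ln y"
      by (simp add: sum_divide_distrib[symmetric] sum_subtractf)
    finally show ?thesis using u by (simp add: smooth_density_def Psi_def smooth_upto_def powr_minus_divide)
  qed
  have "((\<lambda>u. \<Sum>n\<in>?F u. 1 / real n) \<longlongrightarrow> 1 / prime_prod y) at_top"
  proof (rule filterlim_compose[OF smooth_reciprocal_has_sum[unfolded has_sum_def]])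
    show "filterlim ?F (finite_subsets_at_top (smooth y)) at_top"
      unfolding filterlim_finite_subsets_at_top
    proof (intro allI impI)
      fix X assume X: "finite X \<and> X \<subseteq> smooth y"
      define N where "N = (\<Sum>n\<in>X. real n)"
      have N: "real n \<le> N" if "n \<in> X" for n unfolding N_def using X that by (intro member_le_sum) auto
      have "LIM u at_top. ln y * u :> at_top"
        using y by (intro filterlim_tendsto_pos_mult_at_top[OF tendsto_const] filterlim_ident) auto
      then have "filterlim (\<lambda>u. exp (ln y * u)) at_top at_top"
        by (rule filterlim_compose[OF exp_at_top])
      then have "filterlim (\<lambda>u. y powr u) at_top at_top"
        using y by (simp add: powr_def mult.commute)
      then have "\<forall>\<^sub>F u in at_top. N \<le> y powr u" by (simp add: filterlim_at_top)
      then show "\<forall>\<^sub>F u in at_top. finite (?F u) \<and> X \<subseteq> ?F u \<and> ?F u \<subseteq> smooth y"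
      proof eventually_elim
        case (elim u)
        have "X \<subseteq> ?F u" using N X elim by (force simp: smooth_upto_def)
        then show ?case using finite_smooth_upto by (auto simp: smooth_upto_def)
      qed
    qed
  qed
  then have "((\<lambda>u. ((\<Sum>n\<in>?F u. 1 / real n) - smooth_density y u) / ln y) \<longlongrightarrow> (1 / prime_prod y - 0) / ln y) at_top"
    using y by (intro tendsto_intros smooth_density_tendsto_0) auto
  then have "(conv step (smooth_density y) \<longlongrightarrow> (1 / prime_prod y - 0) / ln y) at_top"
    by (rule Lim_transform_eventually)
      (use eq in \<open>auto intro!: eventually_at_top_linorderI[of 0]\<close>)
  with conv_step_tendsto[OF int] have "(LINT v|lborel. smooth_density y v) = (1 / prime_prod y - 0) / ln y"
    using tendsto_unique trivial_limit_at_top_linorder by blast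
  then show ?thesis using int by (simp add: has_bochner_integral_iff)
qed

definition frac_density :: "real \<Rightarrow> real \<Rightarrow> real" where
  "frac_density y v = step v * (frac (y powr v) / y powr v)"

lemma frac_density_bound: "y > 0 \<Longrightarrow> v \<ge> 0 \<Longrightarrow> \<bar>frac_density y v\<bar> \<le> exp (- ln y * v)"
  using frac_lt_1[of "y powr v"] frac_ge_0[of "y powr v"]
  by (simp add: frac_density_def powr_def exp_minus field_simps)

lemma causal_frac_density: assumes y: "y > 1" shows "causal (frac_density y)"
proof (rule causal_boundedI)
  show "frac_density y \<in> borel_measurable borel"
    unfolding frac_density_def [abs_def] frac_def by measurable
  show "\<bar>frac_density y t\<bar> \<le> 1" if "t \<ge> 0" for t
    using frac_density_bound[of y t] y that by (auto intro: order_trans)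
qed (simp add: frac_density_def)

definition lambda_density :: "real \<Rightarrow> real \<Rightarrow> real" where
  "lambda_density y u = dickman u - frac_density y u - conv dickman' (frac_density y) u"

lemma causal_lambda_density: "y > 1 \<Longrightarrow> causal (lambda_density y)"
  unfolding lambda_density_def [abs_def]
  by (intro causal_diff causal_conv causal_dickman causal_dickman' causal_frac_density)

lemma Lambda_eq:
  assumes y: "y > 1" and u: "u \<ge> 0"
  shows "Lambda (y powr u) y = y powr u * lambda_density y u"
proof -
  have "ln (y powr u) / ln y = u" using y by (simp add: ln_powr)
  moreover have "integral {0..u} (\<lambda>v. dickman' (u - v) * (frac (y powr v) / y powr v))
      = conv dickman' (frac_density y) u"
    unfolding conv_eq_integral(1)[OF causal_dickman' causal_frac_density[OF y]]
    by (rule integral_cong) (simp add: frac_density_def)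
  ultimately show ?thesis
    using y u by (simp add: Lambda_def Let_def lambda_density_def frac_density_def algebra_simps)
qed

definition delta_density :: "real \<Rightarrow> real \<Rightarrow> real" where
  "delta_density y u = smooth_density y u - lambda_density y u"

lemma causal_delta_density: "y > 1 \<Longrightarrow> causal (delta_density y)"
  unfolding delta_density_def [abs_def]
  by (intro causal_diff causal_smooth_density causal_lambda_density)

lemma Delta_eq:
  assumes y: "y > 1" and u: "u \<ge> 0"
  shows "Delta (y powr u) y = y powr u * delta_density y u"
  using y u by (simp add: Delta_def Lambda_eq delta_density_def smooth_density_def right_diff_distrib)

text \<open>Here the shape of \<open>\<Lambda>\<close> is used: \<open>L = \<rho> - (\<delta> + \<rho>')*g\<close>, and convolution with \<open>\<delta> + \<omega>\<close> undoes the factor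
  \<open>\<delta> + \<rho>'\<close> and maps \<open>\<rho>\<close> to the unit step.\<close>

lemma lambda_density_conv:
  assumes y: "y > 1"
  shows "lambda_density y u + conv buchstab (lambda_density y) u = step u - frac_density y u"
proof -
  note c = causal_dickman causal_dickman' causal_buchstab causal_frac_density[OF y] causal_conv causal_diff
  let ?g = "frac_density y"
  have "conv buchstab (lambda_density y) u
      = conv buchstab dickman u - conv buchstab ?g u - conv buchstab (conv dickman' ?g) u"
    unfolding lambda_density_def [abs_def]
    by (subst conv_diff_right; (intro c)?; subst conv_diff_right; (intro c)?; simp)
  also have "conv buchstab (conv dickman' ?g) = conv (conv dickman' buchstab) ?g"
    by (subst conv_assoc[symmetric]) (auto intro: c simp: conv_commute[of buchstab])
  also have "conv dickman' buchstab = (\<lambda>t. - dickman' t - buchstab t)"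
    using dickman'_buchstab_inverse by (auto simp: fun_eq_iff algebra_simps eq_neg_iff_add_eq_0)
  also have "conv (\<lambda>t. - dickman' t - buchstab t) ?g u = - conv dickman' ?g u - conv buchstab ?g u"
    by (subst conv_diff_left) (auto intro: c causal_uminus simp: conv_def)
  finally show ?thesis using dickman_buchstab[of u] by (simp add: lambda_density_def[of y u])
qed

text \<open>The constant \<open>c\<close>; Mertens' theorem says that it tends to \<open>0\<close> as \<open>y \<rightarrow> \<infinity>\<close>.\<close>

definition mertens_defect :: "real \<Rightarrow> real" where
  "mertens_defect y = 1 - exp (- euler_mascheroni) / (prime_prod y * ln y)"

lemma R_eq_smooth_density:
  assumes y: "y \<ge> 2" and u: "u \<ge> 0"
  shows "R (y powr u) y = y powr u * (smooth_density y u + frac_density y u - 1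
      + mertens_defect y + conv buchstab (smooth_density y) u)"
proof -
  let ?x = "y powr u"
  have y1: "y > 1" using y by simp
  have x: "?x \<ge> 1" using y u by (simp add: ge_one_powr_ge_zero)
  have m: "mu y (ln (?x / real n) / ln y) = conv buchstab (exp_step y) (u - ln (real n) / ln y)"
    if "n \<in> smooth_upto ?x y" for n
  proof -
    have "n > 0" using that by (simp add: smooth_upto_def smooth_def)
    then have "ln (?x / real n) / ln y = u - ln (real n) / ln y"
      using y by (simp add: ln_div ln_powr diff_divide_distrib)
    then show ?thesis using y by (simp add: mu_eq_conv)
  qed
  have "(\<Sum>n\<in>smooth_upto ?x y. 1 / real n * mu y (ln (?x / real n) / ln y)) = conv buchstab (smooth_density y) u"
    unfolding conv_smooth_density[OF y1 causal_buchstab u] by (intro sum.cong refl) (simp add: m)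
  then have "R ?x y = real (Psi ?x y) - of_int \<lfloor>?x\<rfloor> + ?x * mertens_defect y
      + ?x * conv buchstab (smooth_density y) u"
    using R_eq[OF x y] by (simp add: mertens_defect_def)
  also have "real (Psi ?x y) = ?x * smooth_density y u" using y u by (simp add: smooth_density_def)
  also have "of_int \<lfloor>?x\<rfloor> = ?x * (1 - frac_density y u)"
    using y u by (simp add: frac_density_def frac_def field_simps)
  finally show ?thesis by (simp add: algebra_simps)
qed

lemma R_eq_delta_density:
  assumes y: "y \<ge> 2" and u: "u \<ge> 0"
  shows "R (y powr u) y = y powr u * (mertens_defect y + delta_density y u + conv buchstab (delta_density y) u)"
proof -
  have y1: "y > 1" using y by simp
  have "conv buchstab (delta_density y) u = conv buchstab (smooth_density y) u - conv buchstab (lambda_density y) u"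
    unfolding delta_density_def [abs_def]
    by (intro conv_diff_right causal_smooth_density causal_lambda_density causal_buchstab y1)
  then have "smooth_density y u + frac_density y u - 1 + mertens_defect y + conv buchstab (smooth_density y) u
      = mertens_defect y + delta_density y u + conv buchstab (delta_density y) u"
    using lambda_density_conv[OF y1, of u] u by (simp add: delta_density_def[of y u])
  then show ?thesis unfolding R_eq_smooth_density[OF y u] by simp
qed

text \<open>For fixed \<open>y\<close> this says \<open>R(x,y) = o(x)\<close>. In the form \<open>P + g - 1 + c + \<omega>*P\<close> the last term tends to
  \<open>e\<^sup>-\<^sup>\<gamma> \<integral> P = 1 - c\<close>.\<close>

lemma R_density_tendsto_0:
  assumes y: "y \<ge> 2"
  shows "((\<lambda>u. mertens_defect y + delta_density y u + conv buchstab (delta_density y) u) \<longlongrightarrow> 0) at_top"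
proof -
  have y1: "y > 1" using y by simp
  obtain M where M: "\<And>t. \<bar>buchstab t\<bar> \<le> M" using buchstab_bounded by metis
  let ?I = "1 / (prime_prod y * ln y)"
  have "(conv buchstab (smooth_density y) \<longlongrightarrow> exp (- euler_mascheroni) * ?I) at_top"
    using conv_tendsto[OF _ causal_measurable[OF causal_buchstab] M buchstab_tendsto, of "smooth_density y"]
      smooth_density_integral[OF y1] by (auto simp: has_bochner_integral_iff)
  moreover have "(frac_density y \<longlongrightarrow> 0) at_top"
    by (rule exp_bound_tendsto_0[of "ln y" _ 1]) (use frac_density_bound[of y] y in auto)
  ultimately have "((\<lambda>u. smooth_density y u + frac_density y u - 1 + mertens_defect y + conv buchstab (smooth_density y) u)
      \<longlongrightarrow> 0 + 0 - 1 + mertens_defect y + exp (- euler_mascheroni) * ?I) at_top"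
    by (intro tendsto_intros smooth_density_tendsto_0 y1)
  moreover have "0 + 0 - 1 + mertens_defect y + exp (- euler_mascheroni) * ?I = 0"
    by (simp add: mertens_defect_def)
  ultimately have *: "((\<lambda>u. smooth_density y u + frac_density y u - 1 + mertens_defect y + conv buchstab (smooth_density y) u)
      \<longlongrightarrow> 0) at_top" by simp
  show ?thesis
  proof (rule Lim_transform_eventually[OF *])
    show "\<forall>\<^sub>F u in at_top. smooth_density y u + frac_density y u - 1 + mertens_defect y + conv buchstab (smooth_density y) u
       = mertens_defect y + delta_density y u + conv buchstab (delta_density y) u"
      using eventually_ge_at_top[of 0]
    proof eventually_elim
      case (elim u)
      then show ?case
        using R_eq_delta_density[OF y elim] R_eq_smooth_density[OF y elim] y by simp
    qed
  qed
qed

section \<open>Transfer of exponential bounds\<close>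

text \<open>Pull \<open>e\<^sup>-\<^sup>A\<^sup>u\<close> out of \<open>k(u - v) e\<^sup>-\<^sup>A\<^sup>v = e\<^sup>-\<^sup>A\<^sup>u k(u - v) e\<^bsup>A(u - v)\<^esup>\<close>.\<close>

lemma conv_preserves_exp_bound:
  assumes k: "integrable lborel (\<lambda>t. \<bar>k t\<bar> * exp (A * t))"
    and km [measurable]: "k \<in> borel_measurable borel" "D \<in> borel_measurable borel"
    and D: "\<And>v. \<bar>D v\<bar> \<le> C * exp (- A * v)"
  shows "\<bar>conv k D u\<bar> \<le> C * exp (- A * u) * (LINT t|lborel. \<bar>k t\<bar> * exp (A * t))"
proof -
  have C: "C \<ge> 0" using D[of 0] abs_ge_zero[of "D 0"] by simp
  have sub: "integrable lborel (\<lambda>v. \<bar>k (u - v)\<bar> * exp (A * (u - v)))"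
    using lborel_integrable_real_affine[OF k, of "-1" u] by simp
  have "(LINT t|lborel. \<bar>k t\<bar> * exp (A * t)) = (LINT v|lborel. \<bar>k (u - v)\<bar> * exp (A * (u - v)))"
    using lborel_integral_real_affine[of "-1" "\<lambda>t. \<bar>k t\<bar> * exp (A * t)" u] by simp
  moreover have "\<bar>conv k D u\<bar> \<le> (LINT v|lborel. C * exp (- A * u) * (\<bar>k (u - v)\<bar> * exp (A * (u - v))))"
  proof -
    have le: "\<bar>k (u - v) * D v\<bar> \<le> C * exp (- A * u) * (\<bar>k (u - v)\<bar> * exp (A * (u - v)))" for v
    proof -
      have "\<bar>k (u - v) * D v\<bar> \<le> \<bar>k (u - v)\<bar> * (C * exp (- A * v))"
        unfolding abs_mult by (intro mult_left_mono D) auto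
      also have "exp (- A * v) = exp (- A * u) * exp (A * (u - v))"
        by (simp add: exp_add[symmetric] algebra_simps)
      finally show ?thesis by (simp add: algebra_simps)
    qed
    have dom: "integrable lborel (\<lambda>v. C * exp (- A * u) * (\<bar>k (u - v)\<bar> * exp (A * (u - v))))"
      by (intro integrable_mult_right sub)
    have "integrable lborel (\<lambda>v. k (u - v) * D v)"
    proof (rule Bochner_Integration.integrable_bound[OF dom])
      have "norm (k (u - v) * D v) \<le> norm (C * exp (- A * u) * (\<bar>k (u - v)\<bar> * exp (A * (u - v))))" for v
        using le[of v] C by simp
      then show "AE v in lborel. norm (k (u - v) * D v) \<le> norm (C * exp (- A * u) * (\<bar>k (u - v)\<bar> * exp (A * (u - v))))"
        by simp
    qed measurable
    then show ?thesis unfolding conv_def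
      by (intro integral_abs_bound[THEN order_trans] integral_mono dom le integrable_abs)
  qed
  ultimately show ?thesis by simp
qed

lemma dickman'_weighted_integrable: "integrable lborel (\<lambda>t. \<bar>dickman' t\<bar> * exp (A * t))"
proof -
  have "integrable lborel (\<lambda>t. exp \<bar>A\<bar> * (dickman (t - 1) * exp (A * (t - 1))))"
    using lborel_integrable_real_affine[OF dickman_exp_integrable[of A], of 1 "-1"] by simp
  then show ?thesis
  proof (rule Bochner_Integration.integrable_bound)
    show "(\<lambda>t. \<bar>dickman' t\<bar> * exp (A * t)) \<in> borel_measurable lborel"
      using causal_measurable[OF causal_dickman'] by measurable
    have "norm (\<bar>dickman' t\<bar> * exp (A * t)) \<le> norm (exp \<bar>A\<bar> * (dickman (t - 1) * exp (A * (t - 1))))" for t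
    proof (cases "t < 1")
      case False
      have "\<bar>dickman' t\<bar> \<le> \<bar>dickman (t - 1)\<bar> / 1"
        unfolding dickman'_eq abs_divide abs_minus_cancel using False by (intro frac_le) auto
      moreover have "exp (A * t) \<le> exp \<bar>A\<bar> * exp (A * (t - 1))"
        by (simp add: exp_add[symmetric] algebra_simps)
      ultimately have "\<bar>dickman' t\<bar> * exp (A * t) \<le> \<bar>dickman (t - 1)\<bar> * (exp \<bar>A\<bar> * exp (A * (t - 1)))"
        by (intro mult_mono) auto
      then show ?thesis by (simp add: abs_mult mult.assoc mult.left_commute)
    qed (simp add: dickman'_lt_1)
    then show "AE t in lborel. norm (\<bar>dickman' t\<bar> * exp (A * t)) \<le> norm (exp \<bar>A\<bar> * (dickman (t - 1) * exp (A * (t - 1))))"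
      by simp
  qed
qed

text \<open>Not causal: on the negative axis it is the constant \<open>-e\<^sup>-\<^sup>\<gamma>\<close>, where the weight \<open>e\<^sup>A\<^sup>t\<close> makes it integrable.\<close>

definition buchstab_dev :: "real \<Rightarrow> real" where
  "buchstab_dev t = buchstab t - exp (- euler_mascheroni)"

lemma buchstab_dev_measurable [measurable]: "buchstab_dev \<in> borel_measurable borel"
  using causal_measurable[OF causal_buchstab] unfolding buchstab_dev_def [abs_def] by measurable

lemma buchstab_weighted_integrable:
  assumes A: "A > 0"
  shows "integrable lborel (\<lambda>t. \<bar>buchstab_dev t\<bar> * exp (A * t))"
proof -
  obtain K where K: "K \<ge> 0" "\<And>u. u \<ge> 0 \<Longrightarrow> \<bar>buchstab_dev u\<bar> \<le> K * exp (- (A + 1) * u)"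
    using buchstab_decay[of "A + 1"] A unfolding buchstab_dev_def by auto
  let ?c = "exp (- euler_mascheroni) :: real"
  let ?d = "\<lambda>t. K * (indicator {0..} t * exp (- 1 * t)) + ?c * (indicator {0..} (- t) * exp (- A * - t))"
  have i0: "integrable lborel (\<lambda>t :: real. indicator {0..} t * exp (- A * t))"
    by (rule exp_tail_integrable[OF A])
  have i1: "integrable lborel (\<lambda>t :: real. indicator {0..} (- t) * exp (- A * - t))"
    using lborel_integrable_real_affine[OF i0, of "-1" 0] by simp
  have i2: "integrable lborel (\<lambda>t :: real. indicator {0..} t * exp (- 1 * t))"
    by (rule exp_tail_integrable) simp
  have "integrable lborel ?d"
    by (intro Bochner_Integration.integrable_add integrable_mult_right i1 i2)
  then show ?thesis
  proof (rule Bochner_Integration.integrable_bound)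
    show "(\<lambda>t. \<bar>buchstab_dev t\<bar> * exp (A * t)) \<in> borel_measurable lborel" by measurable
    have "norm (\<bar>buchstab_dev t\<bar> * exp (A * t)) \<le> norm (?d t)" for t
    proof (cases "t \<ge> 0")
      case True
      have "\<bar>buchstab_dev t\<bar> * exp (A * t) \<le> K * exp (- (A + 1) * t) * exp (A * t)"
        using K(2)[OF True] by (intro mult_right_mono) auto
      also have "\<dots> = K * exp (- 1 * t)" by (simp add: exp_add[symmetric] algebra_simps)
      also have "\<dots> \<le> ?d t" using True by simp
      finally show ?thesis by simp
    next
      case False
      then show ?thesis by (simp add: buchstab_dev_def buchstab_lt_1)
    qed
    then show "AE t in lborel. norm (\<bar>buchstab_dev t\<bar> * exp (A * t)) \<le> norm (?d t)" by simp
  qed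
qed

text \<open>Convolve \<open>E = c e + D + \<omega>*D\<close> with \<open>\<delta> + \<rho>'\<close>, the inverse of \<open>\<delta> + \<omega>\<close>; the unit step becomes \<open>\<rho>\<close>.\<close>

lemma dickman'_inverts_buchstab:
  assumes D: "causal D"
  shows "D u = (c * step u + D u + conv buchstab D u)
    + conv dickman' (\<lambda>v. c * step v + D v + conv buchstab D v) u - c * dickman u"
proof -
  note c = causal_dickman' causal_buchstab causal_step D causal_conv causal_add causal_scale
  have "conv dickman' (\<lambda>v. c * step v + D v + conv buchstab D v) u
      = c * conv dickman' step u + conv dickman' D u + conv dickman' (conv buchstab D) u"
    by (subst conv_add_right; (intro c)?; subst conv_add_right; (intro c)?; simp add: conv_scale_right)
  also have "conv dickman' step u = dickman u - step u"
    using conv_step_dickman'[of u] by (simp add: conv_commute)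
  also have "conv dickman' (conv buchstab D) = conv (conv dickman' buchstab) D"
    by (rule conv_assoc[symmetric]) (intro c)+
  also have "conv dickman' buchstab = (\<lambda>t. - dickman' t - buchstab t)"
    using dickman'_buchstab_inverse by (auto simp: fun_eq_iff algebra_simps eq_neg_iff_add_eq_0)
  also have "conv (\<lambda>t. - dickman' t - buchstab t) D u = - conv dickman' D u - conv buchstab D u"
    by (subst conv_diff_left) (auto intro: c causal_uminus simp: conv_def)
  finally show ?thesis by (simp add: algebra_simps)
qed

text \<open>The limit of \<open>c + D + \<omega>*D\<close> is \<open>c + e\<^sup>-\<^sup>\<gamma> \<integral> D\<close>. If it is \<open>0\<close>, subtracting it replaces \<open>\<omega>\<close> by
  \<open>\<omega> - e\<^sup>-\<^sup>\<gamma>\<close> in the convolution, a kernel with enough decay to preserve the bound for \<open>D\<close>.\<close>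

lemma buchstab_transform_bound:
  assumes A: "A > 0" and D: "causal D" "\<And>u. u \<ge> 0 \<Longrightarrow> \<bar>D u\<bar> \<le> C * exp (- A * u)"
    and lim: "((\<lambda>u. c + D u + conv buchstab D u) \<longlongrightarrow> 0) at_top" and u: "u \<ge> 0"
  shows "\<bar>c + D u + conv buchstab D u\<bar>
    \<le> (1 + (LINT t|lborel. \<bar>buchstab_dev t\<bar> * exp (A * t))) * (C * exp (- A * u))"
proof -
  let ?l = "exp (- euler_mascheroni) :: real" and ?J = "LINT v|lborel. D v"
  have C: "C \<ge> 0" using D(2)[of 0] abs_ge_zero[of "D 0"] by simp
  have D': "\<bar>D v\<bar> \<le> C * exp (- A * v)" for v
    using D(2)[of v] C causal_neg[OF D(1), of v] by (cases "v < 0") auto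
  have int: "integrable lborel D" by (rule integrable_exp_bound[OF D(1) A D(2)])
  obtain M where M: "\<And>t. \<bar>buchstab t\<bar> \<le> M" using buchstab_bounded by metis
  have "((\<lambda>u. c + D u + conv buchstab D u) \<longlongrightarrow> c + 0 + ?l * ?J) at_top"
    by (intro tendsto_intros exp_bound_tendsto_0[OF A D(2)]
        conv_tendsto[OF int causal_measurable[OF causal_buchstab] M buchstab_tendsto])
  then have "c + 0 + ?l * ?J = 0" using lim tendsto_unique trivial_limit_at_top_linorder by blast
  moreover have "conv buchstab_dev D u = conv buchstab D u - ?l * ?J"
  proof -
    have "conv buchstab_dev D u = (LINT v|lborel. buchstab (u - v) * D v - ?l * D v)"
      by (simp add: conv_def buchstab_dev_def left_diff_distrib)
    also have "\<dots> = (LINT v|lborel. buchstab (u - v) * D v) - (LINT v|lborel. ?l * D v)"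
      by (intro Bochner_Integration.integral_diff conv_integrable causal_buchstab D integrable_mult_right int)
    finally show ?thesis by (simp add: conv_def)
  qed
  ultimately have "c + D u + conv buchstab D u = D u + conv buchstab_dev D u" by simp
  moreover have "\<bar>conv buchstab_dev D u\<bar> \<le> C * exp (- A * u) * (LINT t|lborel. \<bar>buchstab_dev t\<bar> * exp (A * t))"
    by (intro conv_preserves_exp_bound buchstab_weighted_integrable A buchstab_dev_measurable causal_measurable D D')
  ultimately have "\<bar>c + D u + conv buchstab D u\<bar>
      \<le> C * exp (- A * u) + C * exp (- A * u) * (LINT t|lborel. \<bar>buchstab_dev t\<bar> * exp (A * t))"
    using D'[of u] by linarith
  also have "\<dots> = (1 + (LINT t|lborel. \<bar>buchstab_dev t\<bar> * exp (A * t))) * (C * exp (- A * u))"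
    by (simp add: algebra_simps)
  finally show ?thesis .
qed

lemma dickman_transform_bound:
  assumes D: "causal D"
    and E: "\<And>u. u \<ge> 0 \<Longrightarrow> \<bar>c + D u + conv buchstab D u\<bar> \<le> C * exp (- A * u)"
    and c: "\<bar>c\<bar> \<le> C" and K: "\<And>u. u \<ge> 0 \<Longrightarrow> \<bar>dickman u\<bar> \<le> K * exp (- A * u)" and u: "u \<ge> 0"
  shows "\<bar>D u\<bar> \<le> (1 + (LINT t|lborel. \<bar>dickman' t\<bar> * exp (A * t)) + K) * (C * exp (- A * u))"
proof -
  let ?E = "\<lambda>v. c * step v + D v + conv buchstab D v"
  have C: "C \<ge> 0" using c by simp
  have cE: "causal ?E" by (intro causal_add causal_scale causal_step causal_conv D causal_buchstab)
  have E': "\<bar>?E v\<bar> \<le> C * exp (- A * v)" for v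
    using E[of v] C causal_neg[OF cE, of v] by (cases "v < 0") auto
  have "\<bar>conv dickman' ?E u\<bar> \<le> C * exp (- A * u) * (LINT t|lborel. \<bar>dickman' t\<bar> * exp (A * t))"
    by (intro conv_preserves_exp_bound dickman'_weighted_integrable causal_measurable causal_dickman' cE E')
  moreover have "\<bar>c * dickman u\<bar> \<le> C * (K * exp (- A * u))"
    unfolding abs_mult using c K[OF u] C by (intro mult_mono) auto
  moreover have "D u = ?E u + conv dickman' ?E u - c * dickman u"
    by (rule dickman'_inverts_buchstab[OF D])
  ultimately have "\<bar>D u\<bar> \<le> C * exp (- A * u) + C * exp (- A * u) * (LINT t|lborel. \<bar>dickman' t\<bar> * exp (A * t)) + C * (K * exp (- A * u))"
    using E'[of u] by linarith
  also have "\<dots> = (1 + (LINT t|lborel. \<bar>dickman' t\<bar> * exp (A * t)) + K) * (C * exp (- A * u))"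
    by (simp add: algebra_simps)
  finally show ?thesis .
qed

text \<open>\<open>\<Psi>(1,y) = \<Lambda>(1,y) = 1\<close>. So the value of \<open>R/x\<close> at \<open>x = 1\<close> is exactly \<open>c\<close>.\<close>

lemma delta_density_0: "y > 1 \<Longrightarrow> delta_density y 0 = 0"
proof -
  assume y: "y > 1"
  have "smooth_upto 1 y = {1}" using y by (auto simp: smooth_upto_def smooth_def)
  then have "smooth_density y 0 = 1"
    using y by (simp add: smooth_density_def Psi_def smooth_upto_def)
  moreover have "conv dickman' (frac_density y) 0 = 0"
    using conv_eq_integral(1)[OF causal_dickman' causal_frac_density[OF y], of 0] by simp
  moreover have "frac_density y 0 = 0" using y by (simp add: frac_density_def)
  ultimately show ?thesis by (simp add: delta_density_def lambda_density_def dickman_unit)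
qed

text \<open>The substitution \<open>x = y\<^sup>u\<close>, under which \<open>x \<ge> 1\<close> corresponds to \<open>u \<ge> 0\<close>.\<close>

lemma bound_iff_log_scale:
  fixes F :: "real \<Rightarrow> real \<Rightarrow> real"
  assumes "y\<^sub>0 > 1"
    and F: "\<And>u y. u \<ge> 0 \<Longrightarrow> y \<ge> y\<^sub>0 \<Longrightarrow> F (y powr u) y = y powr u * g y u"
  shows "(\<forall>x\<ge>1. \<forall>y\<ge>y\<^sub>0. \<bar>F x y\<bar> \<le> C * (x * f y * exp (- A * (ln x / ln y))))
    \<longleftrightarrow> (\<forall>y\<ge>y\<^sub>0. \<forall>u\<ge>0. \<bar>g y u\<bar> \<le> C * f y * exp (- A * u))"
proof -
  have iff: "\<bar>F x y\<bar> \<le> C * (x * f y * exp (- A * (ln x / ln y))) \<longleftrightarrow> \<bar>g y u\<bar> \<le> C * f y * exp (- A * u)"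
    if "y \<ge> y\<^sub>0" "u \<ge> 0" and x: "x = y powr u" for x y u
  proof -
    have y: "y > 1" using that assms by simp
    have "ln x / ln y = u" using y x by (simp add: ln_powr)
    moreover have "\<bar>F x y\<bar> = x * \<bar>g y u\<bar>" using F[OF that(2,1)] y x by (simp add: abs_mult)
    moreover have "x > 0" using x y by simp
    moreover have "C * (x * f y * exp (- A * u)) = x * (C * f y * exp (- A * u))" by simp
    ultimately show ?thesis by (simp only: mult_le_cancel_left_pos)
  qed
  show ?thesis
  proof (intro iffI allI impI)
    fix y u :: real assume a: "\<forall>x\<ge>1. \<forall>y\<ge>y\<^sub>0. \<bar>F x y\<bar> \<le> C * (x * f y * exp (- A * (ln x / ln y)))" and "y \<ge> y\<^sub>0" "0 \<le> u"
    moreover have "y powr u \<ge> 1" using calculation assms(1) by (intro ge_one_powr_ge_zero) auto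
    ultimately show "\<bar>g y u\<bar> \<le> C * f y * exp (- A * u)" using iff by blast
  next
    fix x y :: real assume a: "\<forall>y\<ge>y\<^sub>0. \<forall>u\<ge>0. \<bar>g y u\<bar> \<le> C * f y * exp (- A * u)" and xy: "1 \<le> x" "y\<^sub>0 \<le> y"
    have "x = y powr (ln x / ln y)" "ln x / ln y \<ge> 0" using xy assms(1) by (auto simp: powr_def)
    then show "\<bar>F x y\<bar> \<le> C * (x * f y * exp (- A * (ln x / ln y)))" using iff a xy(2) by blast
  qed
qed

theorem corollary4:
  fixes A y\<^sub>0 :: real and f :: "real \<Rightarrow> real"
  assumes "A > 0" and "y\<^sub>0 \<ge> 2" and "\<And>y. y \<ge> y\<^sub>0 \<Longrightarrow> f y > 0"
  shows "(\<exists>C. \<forall>x\<ge>1. \<forall>y\<ge>y\<^sub>0. \<bar>R x y\<bar> \<le> C * (x * f y * exp (- A * (ln x / ln y))))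
     \<longleftrightarrow> (\<exists>C. \<forall>x\<ge>1. \<forall>y\<ge>y\<^sub>0. \<bar>Delta x y\<bar> \<le> C * (x * f y * exp (- A * (ln x / ln y))))"
proof -
  let ?E = "\<lambda>y u. mertens_defect y + delta_density y u + conv buchstab (delta_density y) u"
  have y0: "y\<^sub>0 > 1" using assms(2) by simp
  have R: "(\<forall>x\<ge>1. \<forall>y\<ge>y\<^sub>0. \<bar>R x y\<bar> \<le> C * (x * f y * exp (- A * (ln x / ln y))))
      \<longleftrightarrow> (\<forall>y\<ge>y\<^sub>0. \<forall>u\<ge>0. \<bar>?E y u\<bar> \<le> C * f y * exp (- A * u))" for C
    by (rule bound_iff_log_scale[OF y0]) (rule R_eq_delta_density, use assms(2) in auto)
  have D: "(\<forall>x\<ge>1. \<forall>y\<ge>y\<^sub>0. \<bar>Delta x y\<bar> \<le> C * (x * f y * exp (- A * (ln x / ln y))))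
      \<longleftrightarrow> (\<forall>y\<ge>y\<^sub>0. \<forall>u\<ge>0. \<bar>delta_density y u\<bar> \<le> C * f y * exp (- A * u))" for C
    by (rule bound_iff_log_scale[OF y0]) (rule Delta_eq, use assms(2) in auto)
  show ?thesis
    unfolding R D
  proof
    assume "\<exists>C. \<forall>y\<ge>y\<^sub>0. \<forall>u\<ge>0. \<bar>?E y u\<bar> \<le> C * f y * exp (- A * u)"
    then obtain C where C: "\<And>y u. y \<ge> y\<^sub>0 \<Longrightarrow> u \<ge> 0 \<Longrightarrow> \<bar>?E y u\<bar> \<le> C * f y * exp (- A * u)" by blast
    obtain K where K: "\<And>u. u \<ge> 0 \<Longrightarrow> \<bar>dickman u\<bar> \<le> K * exp (- A * u)"
      using dickman_decay[of A] assms(1) by (metis less_imp_le)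
    show "\<exists>C. \<forall>y\<ge>y\<^sub>0. \<forall>u\<ge>0. \<bar>delta_density y u\<bar> \<le> C * f y * exp (- A * u)"
    proof (intro exI allI impI)
      fix y u assume y: "y \<ge> y\<^sub>0" and u: "(u::real) \<ge> 0"
      have y1: "y > 1" using y y0 by simp
      have "conv buchstab (delta_density y) 0 = 0"
        using conv_eq_integral(1)[OF causal_buchstab causal_delta_density[OF y1], of 0] by simp
      then have "\<bar>mertens_defect y\<bar> \<le> C * f y" using C[OF y, of 0] delta_density_0[OF y1] by simp
      then have "\<bar>delta_density y u\<bar> \<le> (1 + (LINT t|lborel. \<bar>dickman' t\<bar> * exp (A * t)) + K) * (C * f y * exp (- A * u))"
        by (intro dickman_transform_bound[where c = "mertens_defect y"] assms(1) causal_delta_density y1 C y K u)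
      then show "\<bar>delta_density y u\<bar> \<le> (1 + (LINT t|lborel. \<bar>dickman' t\<bar> * exp (A * t)) + K) * C * f y * exp (- A * u)"
        by (simp only: mult.assoc)
    qed
  next
    assume "\<exists>C. \<forall>y\<ge>y\<^sub>0. \<forall>u\<ge>0. \<bar>delta_density y u\<bar> \<le> C * f y * exp (- A * u)"
    then obtain C where C: "\<And>y u. y \<ge> y\<^sub>0 \<Longrightarrow> u \<ge> 0 \<Longrightarrow> \<bar>delta_density y u\<bar> \<le> C * f y * exp (- A * u)" by blast
    show "\<exists>C. \<forall>y\<ge>y\<^sub>0. \<forall>u\<ge>0. \<bar>?E y u\<bar> \<le> C * f y * exp (- A * u)"
    proof (intro exI allI impI)
      fix y u assume y: "y \<ge> y\<^sub>0" and u: "(u::real) \<ge> 0"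
      have "\<bar>?E y u\<bar> \<le> (1 + (LINT t|lborel. \<bar>buchstab_dev t\<bar> * exp (A * t))) * (C * f y * exp (- A * u))"
        using y y0 assms(2) by (intro buchstab_transform_bound assms(1) causal_delta_density C R_density_tendsto_0 u) auto
      then show "\<bar>?E y u\<bar> \<le> (1 + (LINT t|lborel. \<bar>buchstab_dev t\<bar> * exp (A * t))) * C * f y * exp (- A * u)"
        by (simp only: mult.assoc)
    qed
  qed
qed

end
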